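(* Let $\mathcal{C}$ be an ICE-closed subcategory of an abelian length category $\mathcal{A}$. Then $\mathcal{C}$ is equal to the heart of the interval $[\mathsf{F}(\mathcal{C})\cap\mathcal{C}^\perp,\mathsf{F}(\mathcal{C})]$ in $\mathsf{torf}\,\mathcal{A}$, that is, $\mathcal{C}=\mathsf{F}(\mathcal{C})\cap{}^\perp(\mathsf{F}(\mathcal{C})\cap\mathcal{C}^\perp)$ holds.
   Context: All categories are skeletally small; an abelian length category is an abelian category in which every object has finite length. Subcategories are full, closed under isomorphisms, and contain the zero object. A subcategory $\mathcal{C}$ of $\mathcal{A}$ is ICE-closed if it is closed under extensions, and under images and cokernels (in $\mathcal{A}$) of morphisms between objects of $\mathcal{C}$. A torsion-free class in $\mathcal{A}$ is a subcategory closed under extensions and subobjects; $\mathsf{torf}\,\mathcal{A}$ is the set of torsion-free classes ordered by inclusion, and $\mathsf{F}(\mathcal{C})$ is the smallest torsion-free class containing $\mathcal{C}$. $\mathcal{C}^\perp=\{M\in\mathcal{A}\mid\mathrm{Hom}_{\mathcal{A}}(C,M)=0\ \forall C\in\mathcal{C}\}$ and ${}^\perp\mathcal{C}=\{M\in\mathcal{A}\mid\mathrm{Hom}_{\mathcal{A}}(M,C)=0\ \forall C\in\mathcal{C}\}$. The heart of an interval $[\mathcal{G},\mathcal{F}]$ in $\mathsf{torf}\,\mathcal{A}$ is $\mathcal{H}_{[\mathcal{G},\mathcal{F}]}:=\mathcal{F}\cap{}^\perp\mathcal{G}$. *)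

theory Defs
  imports "HOL-Algebra.Group"
begin

section \<open>Abelian categories\<close>

text \<open>
  Objects and arrows live in HOL types, so every category considered here is small.  A skeletally
  small category is equivalent to a small one, and all notions below are invariant under
  equivalence.  \<^term>\<open>Add\<close> and \<^term>\<open>Zer\<close> carry the group structure of the hom-sets.
\<close>

record ('o, 'm) preadd_data =
  Obj :: "'o set"
  Arr :: "'m set"
  Src :: "'m \<Rightarrow> 'o"
  Tgt :: "'m \<Rightarrow> 'o"
  Idn :: "'o \<Rightarrow> 'm"
  Cmp :: "'m \<Rightarrow> 'm \<Rightarrow> 'm"  (infixl \<open>\<cdot>\<index>\<close> 70)
  Add :: "'m \<Rightarrow> 'm \<Rightarrow> 'm"  (infixl \<open>\<boxplus>\<index>\<close> 65)
  Zer :: "'o \<Rightarrow> 'o \<Rightarrow> 'm"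

definition Hom :: "('o, 'm) preadd_data \<Rightarrow> 'o \<Rightarrow> 'o \<Rightarrow> 'm set" where
  "Hom A X Y = {f \<in> Arr A. Src A f = X \<and> Tgt A f = Y}"

definition hom_group :: "('o, 'm) preadd_data \<Rightarrow> 'o \<Rightarrow> 'o \<Rightarrow> 'm monoid" where
  "hom_group A X Y = \<lparr>carrier = Hom A X Y, mult = Add A, one = Zer A X Y\<rparr>"

definition monic :: "('o, 'm) preadd_data \<Rightarrow> 'm \<Rightarrow> bool" where
  "monic A f \<longleftrightarrow> f \<in> Arr A \<and>
    (\<forall>W \<in> Obj A. \<forall>u \<in> Hom A W (Src A f). \<forall>v \<in> Hom A W (Src A f).
      f \<cdot>\<^bsub>A\<^esub> u = f \<cdot>\<^bsub>A\<^esub> v \<longrightarrow> u = v)"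

definition epic :: "('o, 'm) preadd_data \<Rightarrow> 'm \<Rightarrow> bool" where
  "epic A f \<longleftrightarrow> f \<in> Arr A \<and>
    (\<forall>W \<in> Obj A. \<forall>u \<in> Hom A (Tgt A f) W. \<forall>v \<in> Hom A (Tgt A f) W.
      u \<cdot>\<^bsub>A\<^esub> f = v \<cdot>\<^bsub>A\<^esub> f \<longrightarrow> u = v)"

definition iso_arr :: "('o, 'm) preadd_data \<Rightarrow> 'm \<Rightarrow> bool" where
  "iso_arr A f \<longleftrightarrow> f \<in> Arr A \<and>
    (\<exists>g \<in> Hom A (Tgt A f) (Src A f).
      g \<cdot>\<^bsub>A\<^esub> f = Idn A (Src A f) \<and> f \<cdot>\<^bsub>A\<^esub> g = Idn A (Tgt A f))"

definition isomorphic :: "('o, 'm) preadd_data \<Rightarrow> 'o \<Rightarrow> 'o \<Rightarrow> bool" where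
  "isomorphic A X Y \<longleftrightarrow> (\<exists>f \<in> Hom A X Y. iso_arr A f)"

definition zero_obj :: "('o, 'm) preadd_data \<Rightarrow> 'o \<Rightarrow> bool" where
  "zero_obj A Z \<longleftrightarrow> Z \<in> Obj A \<and>
    (\<forall>X \<in> Obj A. (\<exists>!f. f \<in> Hom A Z X) \<and> (\<exists>!f. f \<in> Hom A X Z))"

definition is_kernel :: "('o, 'm) preadd_data \<Rightarrow> 'm \<Rightarrow> 'm \<Rightarrow> bool" where
  "is_kernel A f k \<longleftrightarrow> f \<in> Arr A \<and> k \<in> Arr A \<and> Tgt A k = Src A f \<and>
    f \<cdot>\<^bsub>A\<^esub> k = Zer A (Src A k) (Tgt A f) \<and>
    (\<forall>W \<in> Obj A. \<forall>t \<in> Hom A W (Src A f). f \<cdot>\<^bsub>A\<^esub> t = Zer A W (Tgt A f) \<longrightarrow>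
      (\<exists>!u. u \<in> Hom A W (Src A k) \<and> k \<cdot>\<^bsub>A\<^esub> u = t))"

definition is_cokernel :: "('o, 'm) preadd_data \<Rightarrow> 'm \<Rightarrow> 'm \<Rightarrow> bool" where
  "is_cokernel A f c \<longleftrightarrow> f \<in> Arr A \<and> c \<in> Arr A \<and> Src A c = Tgt A f \<and>
    c \<cdot>\<^bsub>A\<^esub> f = Zer A (Src A f) (Tgt A c) \<and>
    (\<forall>W \<in> Obj A. \<forall>t \<in> Hom A (Tgt A f) W. t \<cdot>\<^bsub>A\<^esub> f = Zer A (Src A f) W \<longrightarrow>
      (\<exists>!u. u \<in> Hom A (Tgt A c) W \<and> u \<cdot>\<^bsub>A\<^esub> c = t))"

definition is_image :: "('o, 'm) preadd_data \<Rightarrow> 'm \<Rightarrow> 'm \<Rightarrow> bool" where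
  "is_image A f m \<longleftrightarrow> (\<exists>c. is_cokernel A f c \<and> is_kernel A c m)"

definition short_exact :: "('o, 'm) preadd_data \<Rightarrow> 'm \<Rightarrow> 'm \<Rightarrow> bool" where
  "short_exact A f g \<longleftrightarrow> is_kernel A g f \<and> is_cokernel A f g"

definition is_biproduct ::
  "('o, 'm) preadd_data \<Rightarrow> 'o \<Rightarrow> 'o \<Rightarrow> 'o \<Rightarrow> 'm \<Rightarrow> 'm \<Rightarrow> 'm \<Rightarrow> 'm \<Rightarrow> bool" where
  "is_biproduct A X Y P i j p q \<longleftrightarrow> P \<in> Obj A \<and>
    i \<in> Hom A X P \<and> j \<in> Hom A Y P \<and> p \<in> Hom A P X \<and> q \<in> Hom A P Y \<and>
    p \<cdot>\<^bsub>A\<^esub> i = Idn A X \<and> q \<cdot>\<^bsub>A\<^esub> j = Idn A Y \<and>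
    p \<cdot>\<^bsub>A\<^esub> j = Zer A Y X \<and> q \<cdot>\<^bsub>A\<^esub> i = Zer A X Y \<and>
    (i \<cdot>\<^bsub>A\<^esub> p) \<boxplus>\<^bsub>A\<^esub> (j \<cdot>\<^bsub>A\<^esub> q) = Idn A P"

locale preadditive_category =
  fixes A :: "('o, 'm) preadd_data" (structure)
  assumes Src_closed: "f \<in> Arr A \<Longrightarrow> Src A f \<in> Obj A"
    and Tgt_closed: "f \<in> Arr A \<Longrightarrow> Tgt A f \<in> Obj A"
    and Idn_closed: "X \<in> Obj A \<Longrightarrow> Idn A X \<in> Hom A X X"
    and Cmp_closed: "\<lbrakk>f \<in> Hom A X Y; g \<in> Hom A Y Z\<rbrakk> \<Longrightarrow> g \<cdot> f \<in> Hom A X Z"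
    and Cmp_Idn_right: "f \<in> Hom A X Y \<Longrightarrow> f \<cdot> Idn A X = f"
    and Cmp_Idn_left: "f \<in> Hom A X Y \<Longrightarrow> Idn A Y \<cdot> f = f"
    and Cmp_assoc: "\<lbrakk>f \<in> Hom A W X; g \<in> Hom A X Y; h \<in> Hom A Y Z\<rbrakk>
      \<Longrightarrow> (h \<cdot> g) \<cdot> f = h \<cdot> (g \<cdot> f)"
    and hom_comm_group: "\<lbrakk>X \<in> Obj A; Y \<in> Obj A\<rbrakk> \<Longrightarrow> comm_group (hom_group A X Y)"
    and Cmp_Add_right: "\<lbrakk>f \<in> Hom A X Y; f' \<in> Hom A X Y; g \<in> Hom A Y Z\<rbrakk>
      \<Longrightarrow> g \<cdot> (f \<boxplus> f') = (g \<cdot> f) \<boxplus> (g \<cdot> f')"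
    and Cmp_Add_left: "\<lbrakk>f \<in> Hom A X Y; g \<in> Hom A Y Z; g' \<in> Hom A Y Z\<rbrakk>
      \<Longrightarrow> (g \<boxplus> g') \<cdot> f = (g \<cdot> f) \<boxplus> (g' \<cdot> f)"

locale abelian_category = preadditive_category +
  assumes ex_zero_obj: "\<exists>Z. zero_obj A Z"
    and ex_biproduct: "\<lbrakk>X \<in> Obj A; Y \<in> Obj A\<rbrakk> \<Longrightarrow> \<exists>P i j p q. is_biproduct A X Y P i j p q"
    and ex_kernel: "f \<in> Arr A \<Longrightarrow> \<exists>k. is_kernel A f k"
    and ex_cokernel: "f \<in> Arr A \<Longrightarrow> \<exists>c. is_cokernel A f c"
    and monic_normal: "monic A m \<Longrightarrow> \<exists>f. is_kernel A f m"
    and epic_normal: "epic A e \<Longrightarrow> \<exists>f. is_cokernel A f e"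

definition simple_obj :: "('o, 'm) preadd_data \<Rightarrow> 'o \<Rightarrow> bool" where
  "simple_obj A S \<longleftrightarrow> S \<in> Obj A \<and> \<not> zero_obj A S \<and>
    (\<forall>m. monic A m \<and> Tgt A m = S \<longrightarrow> zero_obj A (Src A m) \<or> iso_arr A m)"

text \<open>A composition series \<open>0 = S 0 \<rightarrow> S 1 \<rightarrow> \<dots> \<rightarrow> S n = X\<close>: the arrows \<open>s i\<close> are the inclusions
  and the arrows \<open>c i\<close> the projections onto the simple factors.\<close>

definition finite_length :: "('o, 'm) preadd_data \<Rightarrow> 'o \<Rightarrow> bool" where
  "finite_length A X \<longleftrightarrow> (\<exists>(n::nat) (S :: nat \<Rightarrow> 'o) (s :: nat \<Rightarrow> 'm) (c :: nat \<Rightarrow> 'm).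
    zero_obj A (S 0) \<and> S n = X \<and>
    (\<forall>i<n. s i \<in> Hom A (S i) (S (Suc i)) \<and> short_exact A (s i) (c i) \<and>
      simple_obj A (Tgt A (c i))))"

locale abelian_length_category = abelian_category +
  assumes finite_length: "X \<in> Obj A \<Longrightarrow> finite_length A X"

section \<open>Subcategories\<close>

text \<open>A full subcategory is represented by its set of objects.\<close>

definition subcategory :: "('o, 'm) preadd_data \<Rightarrow> 'o set \<Rightarrow> bool" where
  "subcategory A C \<longleftrightarrow> C \<subseteq> Obj A \<and> (\<exists>Z \<in> C. zero_obj A Z) \<and>
    (\<forall>X Y. X \<in> C \<and> isomorphic A X Y \<longrightarrow> Y \<in> C)"

definition ext_closed :: "('o, 'm) preadd_data \<Rightarrow> 'o set \<Rightarrow> bool" where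
  "ext_closed A C \<longleftrightarrow>
    (\<forall>f g. short_exact A f g \<and> Src A f \<in> C \<and> Tgt A g \<in> C \<longrightarrow> Tgt A f \<in> C)"

definition image_closed :: "('o, 'm) preadd_data \<Rightarrow> 'o set \<Rightarrow> bool" where
  "image_closed A C \<longleftrightarrow>
    (\<forall>f m. is_image A f m \<and> Src A f \<in> C \<and> Tgt A f \<in> C \<longrightarrow> Src A m \<in> C)"

definition coker_closed :: "('o, 'm) preadd_data \<Rightarrow> 'o set \<Rightarrow> bool" where
  "coker_closed A C \<longleftrightarrow>
    (\<forall>f c. is_cokernel A f c \<and> Src A f \<in> C \<and> Tgt A f \<in> C \<longrightarrow> Tgt A c \<in> C)"

definition subobject_closed :: "('o, 'm) preadd_data \<Rightarrow> 'o set \<Rightarrow> bool" where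
  "subobject_closed A C \<longleftrightarrow> (\<forall>m. monic A m \<and> Tgt A m \<in> C \<longrightarrow> Src A m \<in> C)"

definition ICE_closed :: "('o, 'm) preadd_data \<Rightarrow> 'o set \<Rightarrow> bool" where
  "ICE_closed A C \<longleftrightarrow>
    subcategory A C \<and> image_closed A C \<and> coker_closed A C \<and> ext_closed A C"

definition torf :: "('o, 'm) preadd_data \<Rightarrow> 'o set set" where
  "torf A = {T. subcategory A T \<and> ext_closed A T \<and> subobject_closed A T}"

definition torf_closure :: "('o, 'm) preadd_data \<Rightarrow> 'o set \<Rightarrow> 'o set" where
  "torf_closure A C = \<Inter> {T \<in> torf A. C \<subseteq> T}"

definition right_perp :: "('o, 'm) preadd_data \<Rightarrow> 'o set \<Rightarrow> 'o set" where
  "right_perp A C = {M \<in> Obj A. \<forall>X \<in> C. Hom A X M = {Zer A X M}}"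

definition left_perp :: "('o, 'm) preadd_data \<Rightarrow> 'o set \<Rightarrow> 'o set" where
  "left_perp A C = {M \<in> Obj A. \<forall>X \<in> C. Hom A M X = {Zer A M X}}"

text \<open>The heart of the interval \<open>[G, F]\<close> of torsion-free classes.\<close>

definition heart :: "('o, 'm) preadd_data \<Rightarrow> 'o set \<Rightarrow> 'o set \<Rightarrow> 'o set" where
  "heart A G F = F \<inter> left_perp A G"

end

theory Submission
  imports Defs
begin

text \<open>
  Write \<open>F\<close> for the torsion-free closure of the ICE-closed subcategory \<open>C\<close> and \<open>G\<close> for the
  intersection of \<open>F\<close> with the right perpendicular category of \<open>C\<close>.  An object of \<open>C\<close> lies in \<open>F\<close> and
  has no nonzero map to \<open>G\<close>, so the content is the converse: an object \<open>X\<close> of \<open>F\<close> without nonzero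
  maps to \<open>G\<close> lies in \<open>C\<close>.

  The key fact is \<open>ICE_closed_image_in_torf_closure\<close>: if \<open>M \<subseteq> X\<close> is the image of a map \<open>D \<rightarrow> X\<close>
  with \<open>D\<close> in \<open>C\<close> and \<open>X\<close> in \<open>F\<close>, then \<open>M\<close> lies in \<open>C\<close> and \<open>X / M\<close> lies in \<open>F\<close>.  For \<open>X\<close> in \<open>C\<close> this
  is closure under images and cokernels.  To reach all of \<open>F\<close> it suffices, by minimality, that the
  objects \<open>X\<close> with this property contain a torsion-free class containing \<open>C\<close>.  The property itself
  does not lend itself to extensions: given \<open>X' \<rightarrow> X \<rightarrow> X''\<close>, the image \<open>J\<close> of \<open>D\<close> in \<open>X''\<close> is in \<open>C\<close>, but \<open>D\<close>
  maps only into the preimage of \<open>J\<close>, which is an extension of \<open>J\<close> by \<open>X'\<close> and not \<open>X'\<close> itself.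
  So the property is demanded not just of \<open>X\<close> but of every extension of an object of \<open>C\<close> by \<open>X\<close>.
  This defines \<open>stable_images\<close>, which is closed under extensions (through two applications
  of the third isomorphism theorem) and under subobjects (through pushouts of extensions).

  The theorem follows by induction on the number of simple factors of \<open>X\<close>.  If \<open>X\<close> receives no
  nonzero map from \<open>C\<close>, then \<open>X\<close> is in \<open>G\<close>, its identity vanishes, and \<open>X\<close> is zero.  Otherwise the
  image \<open>M\<close> of such a map is a nonzero subobject lying in \<open>C\<close>.  The quotient \<open>X / M\<close> is again in \<open>F\<close> and
  without nonzero maps to \<open>G\<close>, and it is shorter than \<open>X\<close> by \<open>has_series_quotient\<close>; so it is in \<open>C\<close>,
  and \<open>X\<close> is an extension of two objects of \<open>C\<close>.
\<close>

section \<open>Arrows in preadditive categories\<close>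

context preadditive_category
begin

text \<open>
  As conditional rewrite rules, facts about \<^const>\<open>Src\<close> and \<^const>\<open>Tgt\<close> have no extra variables in
  their premises, unlike facts about membership in \<^const>\<open>Hom\<close>.  Unfolding the latter therefore lets
  the simplifier check by itself that composites are well formed.
\<close>

lemma Hom_iff [simp]: "f \<in> Hom A X Y \<longleftrightarrow> f \<in> Arr A \<and> Src A f = X \<and> Tgt A f = Y"
  by (auto simp: Hom_def)

lemma Hom_Obj: "f \<in> Hom A X Y \<Longrightarrow> X \<in> Obj A \<and> Y \<in> Obj A"
  using Src_closed Tgt_closed by auto

lemma Idn_simps [simp]:
  assumes "X \<in> Obj A"
  shows "Idn A X \<in> Arr A" "Src A (Idn A X) = X" "Tgt A (Idn A X) = X"
  using Idn_closed[OF assms] by auto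

lemma Cmp_simps [simp]:
  assumes "f \<in> Arr A" "g \<in> Arr A" "Tgt A f = Src A g"
  shows "g \<cdot> f \<in> Arr A" "Src A (g \<cdot> f) = Src A f" "Tgt A (g \<cdot> f) = Tgt A g"
  using Cmp_closed[of f "Src A f" "Src A g" g "Tgt A g"] assms by auto

lemma assoc:
  assumes "f \<in> Arr A" "g \<in> Arr A" "h \<in> Arr A" "Tgt A f = Src A g" "Tgt A g = Src A h"
  shows "(h \<cdot> g) \<cdot> f = h \<cdot> (g \<cdot> f)"
  using assms by (auto intro!: Cmp_assoc)

lemma Idn_right [simp]: "f \<in> Arr A \<Longrightarrow> Src A f = X \<Longrightarrow> f \<cdot> Idn A X = f"
  using Cmp_Idn_right by auto

lemma Idn_left [simp]: "f \<in> Arr A \<Longrightarrow> Tgt A f = X \<Longrightarrow> Idn A X \<cdot> f = f"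
  using Cmp_Idn_left by auto

lemma Zer_simps [simp]:
  assumes "X \<in> Obj A" "Y \<in> Obj A"
  shows "Zer A X Y \<in> Arr A" "Src A (Zer A X Y) = X" "Tgt A (Zer A X Y) = Y"
proof -
  interpret G: comm_group "hom_group A X Y"
    using hom_comm_group assms .
  have "Zer A X Y \<in> Hom A X Y"
    using G.one_closed by (simp add: hom_group_def)
  then show "Zer A X Y \<in> Arr A" "Src A (Zer A X Y) = X" "Tgt A (Zer A X Y) = Y"
    by auto
qed

lemma Add_Zer_left: "f \<in> Hom A X Y \<Longrightarrow> Zer A X Y \<boxplus> f = f"
proof -
  assume f: "f \<in> Hom A X Y"
  interpret G: comm_group "hom_group A X Y"
    using hom_comm_group Hom_Obj[OF f] by blast
  show ?thesis
    using G.l_one[of f] f by (simp add: hom_group_def)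
qed

lemma Add_Zer_right: "f \<in> Hom A X Y \<Longrightarrow> f \<boxplus> Zer A X Y = f"
proof -
  assume f: "f \<in> Hom A X Y"
  interpret G: comm_group "hom_group A X Y"
    using hom_comm_group Hom_Obj[OF f] by blast
  show ?thesis
    using G.r_one[of f] f by (simp add: hom_group_def)
qed

lemma Add_closed: "f \<in> Hom A X Y \<Longrightarrow> g \<in> Hom A X Y \<Longrightarrow> f \<boxplus> g \<in> Hom A X Y"
proof -
  assume f: "f \<in> Hom A X Y" and g: "g \<in> Hom A X Y"
  interpret G: comm_group "hom_group A X Y"
    using hom_comm_group Hom_Obj[OF f] by blast
  show ?thesis
    using G.m_closed[of f g] f g by (simp add: hom_group_def)
qed

lemma Add_idem_Zer:
  assumes f: "f \<in> Hom A X Y" and "f \<boxplus> f = f"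
  shows "f = Zer A X Y"
proof -
  interpret G: comm_group "hom_group A X Y"
    using hom_comm_group Hom_Obj[OF f] by blast
  show ?thesis
    using G.l_cancel_one[of f f] assms by (simp add: hom_group_def)
qed

text \<open>
  The last property packages cancellation, so that the additive inverse can be used without
  mentioning the group structure on the hom-set.
\<close>

lemma Add_inverse:
  assumes f: "f \<in> Hom A X Y"
  obtains f' where "f' \<in> Hom A X Y" "f \<boxplus> f' = Zer A X Y"
    "\<And>g. g \<in> Hom A X Y \<Longrightarrow> g \<boxplus> f' = Zer A X Y \<Longrightarrow> g = f"
proof -
  interpret G: comm_group "hom_group A X Y"
    using hom_comm_group Hom_Obj[OF f] by blast
  have c: "carrier (hom_group A X Y) = Hom A X Y" and m: "mult (hom_group A X Y) = Add A"
    and o: "one (hom_group A X Y) = Zer A X Y"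
    by (simp_all add: hom_group_def)
  let ?f' = "inv\<^bsub>hom_group A X Y\<^esub> f"
  have 1: "?f' \<in> Hom A X Y"
    using G.inv_closed f unfolding c by blast
  have 2: "f \<boxplus> ?f' = Zer A X Y"
    using G.r_inv[of f] f unfolding c m o by blast
  show thesis
    using that[OF 1 2] G.right_cancel[of ?f' _ f] 1 2 f unfolding c m by metis
qed

lemma Cmp_Zer_right [simp]:
  assumes "g \<in> Arr A" "Src A g = Y" "X \<in> Obj A"
  shows "g \<cdot> Zer A X Y = Zer A X (Tgt A g)"
proof -
  have o: "Y \<in> Obj A" "Tgt A g \<in> Obj A"
    using assms Src_closed Tgt_closed by auto
  have z: "Zer A X Y \<in> Hom A X Y" and g: "g \<in> Hom A Y (Tgt A g)"
    using assms o by auto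
  have "g \<cdot> Zer A X Y = g \<cdot> Zer A X Y \<boxplus> g \<cdot> Zer A X Y"
    using Cmp_Add_right[OF z z g] Add_Zer_left[OF z] by simp
  then show ?thesis
    using Add_idem_Zer[OF Cmp_closed[OF z g]] by simp
qed

lemma Cmp_Zer_left [simp]:
  assumes "f \<in> Arr A" "Tgt A f = Y" "Z \<in> Obj A"
  shows "Zer A Y Z \<cdot> f = Zer A (Src A f) Z"
proof -
  have o: "Y \<in> Obj A" "Src A f \<in> Obj A"
    using assms Src_closed Tgt_closed by auto
  have z: "Zer A Y Z \<in> Hom A Y Z" and f: "f \<in> Hom A (Src A f) Y"
    using assms o by auto
  have "Zer A Y Z \<cdot> f = Zer A Y Z \<cdot> f \<boxplus> Zer A Y Z \<cdot> f"
    using Cmp_Add_left[OF f z z] Add_Zer_left[OF z] by simp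
  then show ?thesis
    using Add_idem_Zer[OF Cmp_closed[OF f z]] by simp
qed

lemma monic_cancel:
  assumes "monic A f" "f \<in> Hom A X Y" "u \<in> Hom A W X" "v \<in> Hom A W X" "f \<cdot> u = f \<cdot> v"
  shows "u = v"
proof -
  have "u \<in> Hom A W (Src A f)" "v \<in> Hom A W (Src A f)"
    using assms(2-4) by auto
  then show ?thesis
    using assms(1,5) Hom_Obj[OF assms(3)] unfolding monic_def by blast
qed

lemma monic_Zer:
  assumes "monic A f" "f \<in> Hom A X Y" "u \<in> Hom A W X" "f \<cdot> u = Zer A W Y"
  shows "u = Zer A W X"
  using monic_cancel[OF assms(1-3), of "Zer A W X"] assms Hom_Obj[OF assms(2)] Hom_Obj[OF assms(3)]
  by simp

lemma monicI:
  assumes f: "f \<in> Hom A X Y"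
    and Z: "\<And>W t. t \<in> Hom A W X \<Longrightarrow> f \<cdot> t = Zer A W Y \<Longrightarrow> t = Zer A W X"
  shows "monic A f"
proof -
  have "u = v" if u: "u \<in> Hom A W X" and v: "v \<in> Hom A W X" and e: "f \<cdot> u = f \<cdot> v" for W u v
  proof -
    obtain v' where v': "v' \<in> Hom A W X" "v \<boxplus> v' = Zer A W X"
      "\<And>g. g \<in> Hom A W X \<Longrightarrow> g \<boxplus> v' = Zer A W X \<Longrightarrow> g = v"
      using Add_inverse[OF v] by metis
    have "f \<cdot> (u \<boxplus> v') = f \<cdot> (v \<boxplus> v')"
      using Cmp_Add_right[OF u v'(1) f] Cmp_Add_right[OF v v'(1) f] e by simp
    also have "\<dots> = Zer A W Y"
      using f v' Hom_Obj[OF u] by simp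
    finally show ?thesis
      using Z[OF Add_closed[OF u v'(1)]] v'(3)[OF u] by blast
  qed
  then show ?thesis
    using f by (auto simp: monic_def)
qed

lemma epic_cancel:
  assumes "epic A f" "f \<in> Hom A X Y" "u \<in> Hom A Y W" "v \<in> Hom A Y W" "u \<cdot> f = v \<cdot> f"
  shows "u = v"
proof -
  have "u \<in> Hom A (Tgt A f) W" "v \<in> Hom A (Tgt A f) W"
    using assms(2-4) by auto
  then show ?thesis
    using assms(1,5) Hom_Obj[OF assms(3)] unfolding epic_def by blast
qed

lemma epic_Zer:
  assumes "epic A f" "f \<in> Hom A X Y" "u \<in> Hom A Y W" "u \<cdot> f = Zer A X W"
  shows "u = Zer A Y W"
  using epic_cancel[OF assms(1-3), of "Zer A Y W"] assms Hom_Obj[OF assms(2)] Hom_Obj[OF assms(3)]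
  by simp

lemma monic_Cmp:
  assumes "monic A f" "monic A g" "f \<in> Hom A X Y" "g \<in> Hom A Y Z"
  shows "monic A (g \<cdot> f)"
proof (rule monicI)
  show "g \<cdot> f \<in> Hom A X Z"
    using assms by simp
  fix W t assume t: "t \<in> Hom A W X" "g \<cdot> f \<cdot> t = Zer A W Z"
  then have "g \<cdot> (f \<cdot> t) = Zer A W Z"
    using assms by (simp add: assoc)
  then have "f \<cdot> t = Zer A W Y"
    using monic_Zer[OF assms(2,4), of "f \<cdot> t" W] assms t by simp
  then show "t = Zer A W X"
    by (rule monic_Zer[OF assms(1,3) t(1)])
qed

lemma epic_Cmp:
  assumes "epic A f" "epic A g" "f \<in> Hom A X Y" "g \<in> Hom A Y Z"
  shows "epic A (g \<cdot> f)"
  unfolding epic_def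
proof (intro conjI ballI impI)
  show "g \<cdot> f \<in> Arr A"
    using assms by simp
  fix W u v
  assume uv: "u \<in> Hom A (Tgt A (g \<cdot> f)) W" "v \<in> Hom A (Tgt A (g \<cdot> f)) W"
    "u \<cdot> (g \<cdot> f) = v \<cdot> (g \<cdot> f)"
  then have "(u \<cdot> g) \<cdot> f = (v \<cdot> g) \<cdot> f"
    using assms by (simp add: assoc)
  then have "u \<cdot> g = v \<cdot> g"
    using epic_cancel[OF assms(1,3), of "u \<cdot> g" W "v \<cdot> g"] uv assms by simp
  then show "u = v"
    using epic_cancel[OF assms(2,4), of u W v] uv assms by simp
qed

lemma monic_right_factor:
  assumes "monic A (g \<cdot> f)" "f \<in> Hom A X Y" "g \<in> Hom A Y Z"
  shows "monic A f"
proof (rule monicI[OF assms(2)])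
  fix W t assume t: "t \<in> Hom A W X" "f \<cdot> t = Zer A W Y"
  then have "g \<cdot> f \<cdot> t = Zer A W Z"
    using assms Hom_Obj[OF t(1)] by (simp add: assoc)
  then show "t = Zer A W X"
    using monic_Zer[OF assms(1), of X Z t W] t assms by simp
qed

lemma epic_left_factor:
  assumes "epic A (g \<cdot> f)" "f \<in> Hom A X Y" "g \<in> Hom A Y Z"
  shows "epic A g"
  unfolding epic_def
proof (intro conjI ballI impI)
  show "g \<in> Arr A"
    using assms by simp
  fix W u v
  assume uv: "u \<in> Hom A (Tgt A g) W" "v \<in> Hom A (Tgt A g) W" "u \<cdot> g = v \<cdot> g"
  then have "u \<cdot> (g \<cdot> f) = v \<cdot> (g \<cdot> f)"
    using assms by (simp flip: assoc)
  then show "u = v"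
    using epic_cancel[OF assms(1), of X Z u W v] uv assms by simp
qed

lemma monic_Idn: "X \<in> Obj A \<Longrightarrow> monic A (Idn A X)"
  by (rule monicI[of _ X X]) auto

section \<open>Kernels, cokernels and short exact sequences\<close>

lemma is_kernelD:
  assumes "is_kernel A g k"
  shows "g \<in> Arr A" "k \<in> Arr A" "Tgt A k = Src A g" "g \<cdot> k = Zer A (Src A k) (Tgt A g)"
  using assms unfolding is_kernel_def by auto

lemma is_cokernelD:
  assumes "is_cokernel A g c"
  shows "g \<in> Arr A" "c \<in> Arr A" "Src A c = Tgt A g" "c \<cdot> g = Zer A (Src A g) (Tgt A c)"
  using assms unfolding is_cokernel_def by auto

lemma kernelE:
  assumes "is_kernel A g k" "k \<in> Hom A K Y" "g \<in> Hom A Y Z"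
    and "t \<in> Hom A W Y" "g \<cdot> t = Zer A W Z"
  obtains u where "u \<in> Hom A W K" "k \<cdot> u = t"
proof -
  have e: "Src A k = K" "Tgt A k = Y" "Src A g = Y" "Tgt A g = Z"
    using assms(2,3) by auto
  have "\<exists>!u. u \<in> Hom A W K \<and> k \<cdot> u = t"
    using assms(1,4,5) Hom_Obj[OF assms(4)] unfolding is_kernel_def e by blast
  then show thesis
    using that by blast
qed

lemma cokernelE:
  assumes "is_cokernel A g c" "g \<in> Hom A X Y" "c \<in> Hom A Y Z"
    and "t \<in> Hom A Y W" "t \<cdot> g = Zer A X W"
  obtains u where "u \<in> Hom A Z W" "u \<cdot> c = t"
proof -
  have e: "Src A c = Y" "Tgt A c = Z" "Src A g = X" "Tgt A g = Y"
    using assms(2,3) by auto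
  have "\<exists>!u. u \<in> Hom A Z W \<and> u \<cdot> c = t"
    using assms(1,4,5) Hom_Obj[OF assms(4)] unfolding is_cokernel_def e by blast
  then show thesis
    using that by blast
qed

lemma kernel_monic:
  assumes "is_kernel A g k"
  shows "monic A k"
proof (rule monicI)
  note k = is_kernelD[OF assms]
  show "k \<in> Hom A (Src A k) (Src A g)"
    using k by simp
  fix W t assume t: "t \<in> Hom A W (Src A k)" "k \<cdot> t = Zer A W (Src A g)"
  have W: "W \<in> Obj A"
    using Hom_Obj[OF t(1)] by simp
  have o: "Src A g \<in> Obj A" "Src A k \<in> Obj A"
    using k Src_closed by auto
  have z: "Zer A W (Src A g) \<in> Hom A W (Src A g)"
    "g \<cdot> Zer A W (Src A g) = Zer A W (Tgt A g)"
    using W k(1) o by auto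
  have "\<exists>!u. u \<in> Hom A W (Src A k) \<and> k \<cdot> u = Zer A W (Src A g)"
    using assms W z unfolding is_kernel_def by blast
  moreover have "Zer A W (Src A k) \<in> Hom A W (Src A k)" "k \<cdot> Zer A W (Src A k) = Zer A W (Src A g)"
    using W k o by auto
  ultimately show "t = Zer A W (Src A k)"
    using t by blast
qed

lemma cokernel_epic:
  assumes "is_cokernel A g c"
  shows "epic A c"
  unfolding epic_def
proof (intro conjI ballI impI)
  note c = is_cokernelD[OF assms]
  show "c \<in> Arr A"
    by fact
  fix W u v
  assume uv: "u \<in> Hom A (Tgt A c) W" "v \<in> Hom A (Tgt A c) W" "u \<cdot> c = v \<cdot> c"
  have W: "W \<in> Obj A"
    using Hom_Obj[OF uv(1)] by simp
  have "u \<cdot> c \<in> Hom A (Tgt A g) W"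
    using uv c by simp
  moreover have "u \<cdot> c \<cdot> g = Zer A (Src A g) W"
    using uv c Src_closed by (simp add: assoc)
  ultimately have "\<exists>!w. w \<in> Hom A (Tgt A c) W \<and> w \<cdot> c = u \<cdot> c"
    using assms W unfolding is_cokernel_def by blast
  then show "u = v"
    using uv by metis
qed

text \<open>
  Uniqueness of the factorization is the monic property, so only existence has to be checked.
\<close>

lemma kernelI:
  assumes "monic A k" "k \<in> Hom A K Y" "g \<in> Hom A Y Z" "g \<cdot> k = Zer A K Z"
    and "\<And>W t. t \<in> Hom A W Y \<Longrightarrow> g \<cdot> t = Zer A W Z \<Longrightarrow> \<exists>u \<in> Hom A W K. k \<cdot> u = t"
  shows "is_kernel A g k"
proof -
  have "\<exists>!u. u \<in> Hom A W K \<and> k \<cdot> u = t" if "t \<in> Hom A W Y" "g \<cdot> t = Zer A W Z" for W t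
    using assms(5)[OF that] monic_cancel[OF assms(1,2)] by metis
  moreover have e: "Src A k = K" "Tgt A k = Y" "Src A g = Y" "Tgt A g = Z"
    and "k \<in> Arr A" "g \<in> Arr A"
    using assms(2,3) by auto
  ultimately show ?thesis
    using assms(4) unfolding is_kernel_def e by blast
qed

lemma cokernelI:
  assumes "epic A c" "g \<in> Hom A X Y" "c \<in> Hom A Y Z" "c \<cdot> g = Zer A X Z"
    and "\<And>W t. t \<in> Hom A Y W \<Longrightarrow> t \<cdot> g = Zer A X W \<Longrightarrow> \<exists>u \<in> Hom A Z W. u \<cdot> c = t"
  shows "is_cokernel A g c"
proof -
  have "\<exists>!u. u \<in> Hom A Z W \<and> u \<cdot> c = t" if "t \<in> Hom A Y W" "t \<cdot> g = Zer A X W" for W t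
    using assms(5)[OF that] epic_cancel[OF assms(1,3)] by metis
  moreover have e: "Src A c = Y" "Tgt A c = Z" "Src A g = X" "Tgt A g = Y"
    and "c \<in> Arr A" "g \<in> Arr A"
    using assms(2,3) by auto
  ultimately show ?thesis
    using assms(4) unfolding is_cokernel_def e by blast
qed

lemma zero_obj_Zer:
  assumes "zero_obj A Z"
  shows "f \<in> Hom A X Z \<Longrightarrow> f = Zer A X Z" "f \<in> Hom A Z X \<Longrightarrow> f = Zer A Z X"
proof -
  have Z: "Z \<in> Obj A"
    using assms by (simp add: zero_obj_def)
  show "f = Zer A X Z" if "f \<in> Hom A X Z"
  proof -
    have "Zer A X Z \<in> Hom A X Z"
      using Z Hom_Obj[OF that] by simp
    then show ?thesis
      using assms that Hom_Obj[OF that] unfolding zero_obj_def by blast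
  qed
  show "f = Zer A Z X" if "f \<in> Hom A Z X"
  proof -
    have "Zer A Z X \<in> Hom A Z X"
      using Z Hom_Obj[OF that] by simp
    then show ?thesis
      using assms that Hom_Obj[OF that] unfolding zero_obj_def by blast
  qed
qed

lemma zero_objI:
  assumes X: "X \<in> Obj A" and e: "Idn A X = Zer A X X"
  shows "zero_obj A X"
proof -
  have "f = Zer A X Y" if "f \<in> Hom A X Y" for f Y
    using that e X Hom_Obj[OF that] Idn_right[of f X] by simp
  moreover have "f = Zer A Y X" if "f \<in> Hom A Y X" for f Y
    using that e X Hom_Obj[OF that] Idn_left[of f X] by simp
  moreover have "Zer A X Y \<in> Hom A X Y" "Zer A Y X \<in> Hom A Y X" if "Y \<in> Obj A" for Y
    using X that by auto
  ultimately show ?thesis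
    using X unfolding zero_obj_def by metis
qed

end

section \<open>Exactness in abelian categories\<close>

context abelian_category
begin

lemma kernel_obtain:
  assumes "g \<in> Hom A Y Z"
  obtains K k where "k \<in> Hom A K Y" "is_kernel A g k"
  using ex_kernel[of g] assms is_kernelD[of g] by auto

lemma cokernel_obtain:
  assumes "g \<in> Hom A X Y"
  obtains Z c where "c \<in> Hom A Y Z" "is_cokernel A g c"
  using ex_cokernel[of g] assms is_cokernelD[of g] by auto

text \<open>
  A monic \<open>m\<close> is the kernel of some \<open>f\<close>.  Since \<open>f\<close> kills \<open>m\<close>, it factors through \<open>c\<close>, and
  everything killed by \<open>c\<close> is killed by \<open>f\<close>.
\<close>

lemma monic_kernel_of_cokernel:
  assumes "monic A m" "is_cokernel A m c"
  shows "is_kernel A c m"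
proof -
  obtain X Y Z where m: "m \<in> Hom A X Y" and c: "c \<in> Hom A Y Z"
    using is_cokernelD[OF assms(2)] by auto
  obtain f where "is_kernel A f m"
    using monic_normal assms by blast
  then obtain V where f: "f \<in> Hom A Y V" "is_kernel A f m"
    using is_kernelD[of f m] m by auto
  have "f \<cdot> m = Zer A X V"
    using is_kernelD(4)[OF f(2)] f m by simp
  then obtain v where v: "v \<in> Hom A Z V" "v \<cdot> c = f"
    using cokernelE[OF assms(2) m c f(1)] by metis
  show ?thesis
  proof (rule kernelI[OF assms(1) m c])
    show "c \<cdot> m = Zer A X Z"
      using is_cokernelD(4)[OF assms(2)] c m by simp
    fix W t assume t: "t \<in> Hom A W Y" "c \<cdot> t = Zer A W Z"
    have "f \<cdot> t = v \<cdot> (c \<cdot> t)"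
      using t(1) v c by (auto simp flip: assoc)
    also have "\<dots> = Zer A W V"
      using t v Hom_Obj[OF t(1)] by simp
    finally show "\<exists>u\<in>Hom A W X. m \<cdot> u = t"
      using kernelE[OF f(2) m f(1) t(1)] by metis
  qed
qed

lemma epic_cokernel_of_kernel:
  assumes "epic A e" "is_kernel A e k"
  shows "is_cokernel A k e"
proof -
  obtain X Y Z where k: "k \<in> Hom A X Y" and e: "e \<in> Hom A Y Z"
    using is_kernelD[OF assms(2)] by auto
  obtain f where "is_cokernel A f e"
    using epic_normal assms by blast
  then obtain V where f: "f \<in> Hom A V Y" "is_cokernel A f e"
    using is_cokernelD[of f e] e by auto
  have "e \<cdot> f = Zer A V Z"
    using is_cokernelD(4)[OF f(2)] f e by simp
  then obtain v where v: "v \<in> Hom A V X" "k \<cdot> v = f"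
    using kernelE[OF assms(2) k e f(1)] by metis
  show ?thesis
  proof (rule cokernelI[OF assms(1) k e])
    show "e \<cdot> k = Zer A X Z"
      using is_kernelD(4)[OF assms(2)] k e by simp
    fix W t assume t: "t \<in> Hom A Y W" "t \<cdot> k = Zer A X W"
    have "t \<cdot> f = (t \<cdot> k) \<cdot> v"
      using t(1) v k by (auto simp: assoc)
    also have "\<dots> = Zer A V W"
      using t v Hom_Obj[OF t(1)] by simp
    finally show "\<exists>u\<in>Hom A Z W. u \<cdot> e = t"
      using cokernelE[OF f(2,1) e t(1)] by metis
  qed
qed

lemma short_exact_of_cokernel: "monic A m \<Longrightarrow> is_cokernel A m c \<Longrightarrow> short_exact A m c"
  by (simp add: short_exact_def monic_kernel_of_cokernel)

lemma short_exact_of_kernel: "epic A e \<Longrightarrow> is_kernel A e k \<Longrightarrow> short_exact A k e"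
  by (simp add: short_exact_def epic_cokernel_of_kernel)

lemma short_exactD:
  assumes "short_exact A f g"
  shows "is_kernel A g f" "is_cokernel A f g" "monic A f" "epic A g"
  using assms kernel_monic cokernel_epic by (auto simp: short_exact_def)

lemma short_exact_Hom:
  assumes "short_exact A f g"
  obtains X Y Z where "f \<in> Hom A X Y" "g \<in> Hom A Y Z"
  using is_cokernelD(1-3)[OF short_exactD(2)[OF assms]] by auto

lemma short_exact_Zer:
  assumes "short_exact A f g" "f \<in> Hom A X Y" "g \<in> Hom A Y Z"
  shows "g \<cdot> f = Zer A X Z"
  using is_cokernelD(4)[OF short_exactD(2)[OF assms(1)]] assms by simp

lemma short_exact_kernelE:
  assumes "short_exact A f g" "f \<in> Hom A X Y" "g \<in> Hom A Y Z"
    and "t \<in> Hom A W Y" "g \<cdot> t = Zer A W Z"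
  obtains u where "u \<in> Hom A W X" "f \<cdot> u = t"
  using kernelE[OF short_exactD(1)[OF assms(1)] assms(2-)] by metis

lemma short_exact_cokernelE:
  assumes "short_exact A f g" "f \<in> Hom A X Y" "g \<in> Hom A Y Z"
    and "t \<in> Hom A Y W" "t \<cdot> f = Zer A X W"
  obtains u where "u \<in> Hom A Z W" "u \<cdot> g = t"
  using cokernelE[OF short_exactD(2)[OF assms(1)] assms(2-)] by metis

lemma monic_extend_short_exact:
  assumes "monic A m" "m \<in> Hom A X Y"
  obtains Z c where "c \<in> Hom A Y Z" "short_exact A m c"
  using cokernel_obtain[OF assms(2)] short_exact_of_cokernel[OF assms(1)] by metis

lemma epic_extend_short_exact:
  assumes "epic A e" "e \<in> Hom A Y Z"
  obtains X k where "k \<in> Hom A X Y" "short_exact A k e"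
  using kernel_obtain[OF assms(2)] short_exact_of_kernel[OF assms(1)] by metis

text \<open>
  The cokernel of \<open>f\<close> is zero because \<open>f\<close> is epic, so the identity of the target factors through \<open>f\<close>,
  which is the kernel of its cokernel.
\<close>

lemma iso_arr_of_monic_epic:
  assumes "monic A f" "epic A f"
  shows "iso_arr A f"
proof -
  obtain X Y where f: "f \<in> Hom A X Y"
    using assms by (auto simp: monic_def)
  note o = Hom_Obj[OF f]
  obtain Z c where c: "c \<in> Hom A Y Z" "short_exact A f c"
    using monic_extend_short_exact[OF assms(1) f] .
  have "c = Zer A Y Z"
    using epic_Zer[OF assms(2) f c(1)] short_exact_Zer[OF c(2) f c(1)] .
  then have "c \<cdot> Idn A Y = Zer A Y Z"
    using c o by simp
  then obtain u where u: "u \<in> Hom A Y X" "f \<cdot> u = Idn A Y"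
    using short_exact_kernelE[OF c(2) f c(1), of "Idn A Y" Y] o by auto
  have "f \<cdot> (u \<cdot> f) = f \<cdot> Idn A X"
    using u f o by (simp flip: assoc)
  then have "u \<cdot> f = Idn A X"
    using monic_cancel[OF assms(1) f, of "u \<cdot> f" X "Idn A X"] u f o by simp
  then show ?thesis
    using f u unfolding iso_arr_def by auto
qed

text \<open>
  The map induced by \<open>g\<close> on its coimage \<open>I\<close>.  Suppose that it kills \<open>t\<close>, and let \<open>q\<close> be the cokernel of \<open>t\<close>.
  Then \<open>q \<cdot> c\<close> is epic, hence the cokernel of its kernel \<open>h\<close>.  As \<open>g\<close> factors through \<open>q \<cdot> c\<close>, it
  kills \<open>h\<close>; so \<open>h\<close> factors through \<open>k\<close> and \<open>c\<close> kills \<open>h\<close> as well.  Thus \<open>c\<close> factors through \<open>q \<cdot> c\<close>,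
  which makes \<open>q\<close> split monic, and \<open>t\<close> is zero because \<open>q\<close> kills it.
\<close>

lemma coimage_monic:
  assumes "is_kernel A g k" "is_cokernel A k c" "k \<in> Hom A K X" "c \<in> Hom A X I"
    and n: "n \<in> Hom A I Y" "n \<cdot> c = g"
  shows "monic A n"
proof (rule monicI[OF n(1)])
  have g: "g \<in> Hom A X Y"
    using n assms by auto
  have ec: "epic A c"
    using cokernel_epic[OF assms(2)] .
  fix W t assume t: "t \<in> Hom A W I" "n \<cdot> t = Zer A W Y"
  obtain Q q where q: "q \<in> Hom A I Q" "is_cokernel A t q"
    using cokernel_obtain[OF t(1)] .
  obtain n' where n': "n' \<in> Hom A Q Y" "n' \<cdot> q = n"
    using cokernelE[OF q(2) t(1) q(1) n(1) t(2)] .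
  have "epic A (q \<cdot> c)"
    using epic_Cmp[OF ec cokernel_epic[OF q(2)]] assms q by simp
  then obtain V h where h: "h \<in> Hom A V X" "short_exact A h (q \<cdot> c)"
    using epic_extend_short_exact[of "q \<cdot> c" X Q] assms q by auto
  have qch: "q \<cdot> c \<cdot> h = Zer A V Q"
    using short_exact_Zer[OF h(2,1), of Q] assms q by simp
  have "g \<cdot> h = n' \<cdot> (q \<cdot> c \<cdot> h)"
    using n(2) n'(2) n'(1) q(1) assms(4) h(1) by (auto simp flip: assoc)
  also have "\<dots> = Zer A V Y"
    using qch n'(1) Hom_Obj[OF h(1)] by simp
  finally obtain u where u: "u \<in> Hom A V K" "k \<cdot> u = h"
    using kernelE[OF assms(1,3) g h(1)] by metis
  have "c \<cdot> h = (c \<cdot> k) \<cdot> u"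
    using u assms(3,4) by (auto simp: assoc)
  also have "\<dots> = Zer A V I"
    using is_cokernelD(4)[OF assms(2)] u assms(3,4) Hom_Obj[OF assms(4)] by simp
  finally obtain v where v: "v \<in> Hom A Q I" "v \<cdot> (q \<cdot> c) = c"
    using short_exact_cokernelE[OF h(2,1), of Q c I] assms(4) q(1) by auto
  have oI: "I \<in> Obj A"
    using Hom_Obj[OF n(1)] by simp
  have "v \<cdot> q = Idn A I"
    using epic_cancel[OF ec assms(4), of "v \<cdot> q" I "Idn A I"] v q(1) assms(4) oI
    by (simp add: assoc)
  then have "t = v \<cdot> (q \<cdot> t)"
    using t(1) v(1) q(1) by (simp flip: assoc)
  also have "\<dots> = Zer A W I"
    using is_cokernelD(4)[OF q(2)] t(1) q(1) v(1) Hom_Obj[OF t(1)] by simp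
  finally show "t = Zer A W I" .
qed

lemma epic_monic_factorization:
  assumes g: "g \<in> Hom A X Y"
  obtains I e m where "e \<in> Hom A X I" "m \<in> Hom A I Y" "epic A e" "monic A m" "m \<cdot> e = g"
proof -
  obtain K k where k: "k \<in> Hom A K X" "is_kernel A g k"
    using kernel_obtain[OF g] .
  obtain I c where c: "c \<in> Hom A X I" "is_cokernel A k c"
    using cokernel_obtain[OF k(1)] .
  have "g \<cdot> k = Zer A K Y"
    using is_kernelD(4)[OF k(2)] k g by simp
  then obtain n where n: "n \<in> Hom A I Y" "n \<cdot> c = g"
    using cokernelE[OF c(2) k(1) c(1) g] by metis
  show thesis
    using that[OF c(1) n(1) cokernel_epic[OF c(2)] coimage_monic[OF k(2) c(2) k(1) c(1) n] n(2)] .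
qed

text \<open>
  Connects epi-mono factorizations with images as kernels of cokernels: precomposing with an epic
  changes neither the cokernel nor, therefore, the image.
\<close>

lemma is_image_of_factorization:
  assumes e: "epic A e" "e \<in> Hom A D M" and m: "m \<in> Hom A M Y"
    and c: "short_exact A m c" "c \<in> Hom A Y N"
  shows "is_cokernel A (m \<cdot> e) c" "is_image A (m \<cdot> e) m"
proof -
  show 1: "is_cokernel A (m \<cdot> e) c"
  proof (rule cokernelI[OF short_exactD(4)[OF c(1)] _ c(2)])
    show "m \<cdot> e \<in> Hom A D Y"
      using m e by simp
    have "c \<cdot> (m \<cdot> e) = (c \<cdot> m) \<cdot> e"
      using m e c by (simp add: assoc)
    then show "c \<cdot> (m \<cdot> e) = Zer A D N"
      using short_exact_Zer[OF c(1) m c(2)] e Hom_Obj[OF c(2)] by simp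
    fix W t assume t: "t \<in> Hom A Y W" "t \<cdot> (m \<cdot> e) = Zer A D W"
    then have "t \<cdot> m = Zer A M W"
      using epic_Zer[OF e, of "t \<cdot> m" W] m e by (simp add: assoc)
    then show "\<exists>u\<in>Hom A N W. u \<cdot> c = t"
      using short_exact_cokernelE[OF c(1) m c(2) t(1)] by metis
  qed
  show "is_image A (m \<cdot> e) m"
    using 1 short_exactD(1)[OF c(1)] unfolding is_image_def by blast
qed

text \<open>
  For \<open>X' \<subseteq> X \<subseteq> Y\<close> this is the exact sequence \<open>X / X' \<rightarrow> Y / X' \<rightarrow> Y / X\<close>.  The first map is monic because
  it is induced on the coimage by \<open>q \<cdot> a\<close>, whose kernel is \<open>x'\<close>.
\<close>

lemma third_isomorphism:
  assumes x: "short_exact A x' x''" "x' \<in> Hom A X' X" "x'' \<in> Hom A X X''"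
    and a: "short_exact A a b" "a \<in> Hom A X Y" "b \<in> Hom A Y I"
    and q: "short_exact A (a \<cdot> x') q" "q \<in> Hom A Y Q"
  obtains a' b' where "a' \<in> Hom A X'' Q" "b' \<in> Hom A Q I" "short_exact A a' b'"
    "a' \<cdot> x'' = q \<cdot> a" "b' \<cdot> q = b"
proof -
  have ax: "a \<cdot> x' \<in> Hom A X' Y" and qa: "q \<cdot> a \<in> Hom A X Q"
    using x a q by auto
  have z: "q \<cdot> a \<cdot> x' = Zer A X' Q"
    using short_exact_Zer[OF q(1) ax q(2)] x a q by (simp add: assoc)
  then obtain a' where a': "a' \<in> Hom A X'' Q" "a' \<cdot> x'' = q \<cdot> a"
    using short_exact_cokernelE[OF x qa] by metis
  have "b \<cdot> (a \<cdot> x') = (b \<cdot> a) \<cdot> x'"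
    using x a by (simp add: assoc)
  also have "\<dots> = Zer A X' I"
    using short_exact_Zer[OF a] x Hom_Obj[OF a(3)] by simp
  finally obtain b' where b': "b' \<in> Hom A Q I" "b' \<cdot> q = b"
    using short_exact_cokernelE[OF q(1) ax q(2) a(3)] by metis
  have kx: "is_kernel A (q \<cdot> a) x'"
  proof (rule kernelI[OF short_exactD(3)[OF x(1)] x(2) qa z])
    fix W t assume t: "t \<in> Hom A W X" "q \<cdot> a \<cdot> t = Zer A W Q"
    then have "q \<cdot> (a \<cdot> t) = Zer A W Q"
      using a q by (simp add: assoc)
    then obtain u where u: "u \<in> Hom A W X'" "a \<cdot> x' \<cdot> u = a \<cdot> t"
      using short_exact_kernelE[OF q(1) ax q(2), of "a \<cdot> t" W] t a by auto
    then have "x' \<cdot> u = t"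
      using monic_cancel[OF short_exactD(3)[OF a(1)] a(2), of "x' \<cdot> u" W t] t x a
      by (simp add: assoc)
    then show "\<exists>u\<in>Hom A W X'. x' \<cdot> u = t"
      using u by blast
  qed
  have ma: "monic A a'"
    using coimage_monic[OF kx short_exactD(2)[OF x(1)] x(2,3) a'] .
  have "is_cokernel A a' b'"
  proof (rule cokernelI[OF _ a'(1) b'(1)])
    show "epic A b'"
      using epic_left_factor[OF _ q(2) b'(1)] b'(2) short_exactD(4)[OF a(1)] by simp
    have "b' \<cdot> a' \<cdot> x'' = b' \<cdot> q \<cdot> a"
      using a' b'(1) x(3) q(2) a(2) by (simp add: assoc)
    then have "b' \<cdot> a' \<cdot> x'' = Zer A X I"
      using short_exact_Zer[OF a] b'(2) by simp
    then show "b' \<cdot> a' = Zer A X'' I"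
      using epic_Zer[OF short_exactD(4)[OF x(1)] x(3), of "b' \<cdot> a'" I] a' b' by simp
    fix W t assume t: "t \<in> Hom A Q W" "t \<cdot> a' = Zer A X'' W"
    have "t \<cdot> q \<cdot> a = t \<cdot> a' \<cdot> x''"
      using a' t(1) x(3) q(2) a(2) by (simp add: assoc)
    also have "\<dots> = Zer A X W"
      using t x(3) Hom_Obj[OF t(1)] by simp
    finally obtain u where u: "u \<in> Hom A I W" "u \<cdot> b = t \<cdot> q"
      using short_exact_cokernelE[OF a, of "t \<cdot> q" W] t q by auto
    have "u \<cdot> b' \<cdot> q = t \<cdot> q"
      using u b' q(2) by (simp add: assoc)
    then have "u \<cdot> b' = t"
      using epic_cancel[OF short_exactD(4)[OF q(1)] q(2), of "u \<cdot> b'" W t] t u b' by simp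
    then show "\<exists>u\<in>Hom A I W. u \<cdot> b' = t"
      using u by blast
  qed
  then show thesis
    using that a' b' short_exact_of_cokernel[OF ma] by blast
qed

text \<open>
  The extension \<open>Z \<rightarrow> Y \<rightarrow> I\<close> embeds, along \<open>z\<close>, in an extension of \<open>I\<close> by \<open>X\<close>.  The object \<open>Y'\<close> is the
  cokernel of \<open>h = (z, a)\<close> from \<open>Z\<close> into the direct sum of \<open>X\<close> and \<open>Y\<close>.  Taking \<open>(z, a)\<close> where the usual
  pushout has \<open>(z, - a)\<close> avoids additive inverses; the square with \<open>x\<close> and \<open>y\<close> then commutes only up
  to sign, which does not affect exactness or monicity.
\<close>

lemma pushout_short_exact:
  assumes z: "monic A z" "z \<in> Hom A Z X"
    and a: "short_exact A a b" "a \<in> Hom A Z Y" "b \<in> Hom A Y I"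
  obtains Y' x y b' where "x \<in> Hom A X Y'" "b' \<in> Hom A Y' I" "short_exact A x b'"
    "y \<in> Hom A Y Y'" "monic A y"
proof -
  have o: "X \<in> Obj A" "Y \<in> Obj A" "Z \<in> Obj A" "I \<in> Obj A"
    using Hom_Obj z(2) a(3) by blast+
  obtain P i j p q where bp: "is_biproduct A X Y P i j p q"
    using ex_biproduct o by blast
  have P: "P \<in> Obj A" "i \<in> Hom A X P" "j \<in> Hom A Y P" "p \<in> Hom A P X" "q \<in> Hom A P Y"
    and pi: "p \<cdot> i = Idn A X" and qj: "q \<cdot> j = Idn A Y"
    and pj: "p \<cdot> j = Zer A Y X" and qi: "q \<cdot> i = Zer A X Y"
    and sum: "(i \<cdot> p) \<boxplus> (j \<cdot> q) = Idn A P"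
    using bp unfolding is_biproduct_def by auto
  define h where "h = (i \<cdot> z) \<boxplus> (j \<cdot> a)"
  have iz: "i \<cdot> z \<in> Hom A Z P" and ja: "j \<cdot> a \<in> Hom A Z P"
    using P z a by auto
  have h: "h \<in> Hom A Z P"
    unfolding h_def using Add_closed[OF iz ja] .
  have "p \<cdot> h = (p \<cdot> (i \<cdot> z)) \<boxplus> (p \<cdot> (j \<cdot> a))"
    unfolding h_def using Cmp_Add_right[OF iz ja P(4)] .
  also have "\<dots> = z \<boxplus> Zer A Z X"
    using P z a pi pj o by (simp flip: assoc)
  finally have ph: "p \<cdot> h = z"
    using Add_Zer_right[OF z(2)] by simp
  have "q \<cdot> h = (q \<cdot> (i \<cdot> z)) \<boxplus> (q \<cdot> (j \<cdot> a))"
    unfolding h_def using Cmp_Add_right[OF iz ja P(5)] .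
  also have "\<dots> = Zer A Z Y \<boxplus> a"
    using P z a qi qj o by (simp flip: assoc)
  finally have qh: "q \<cdot> h = a"
    using Add_Zer_left[OF a(2)] by simp
  have mh: "monic A h"
    using monic_right_factor[OF _ h P(4)] ph z(1) by simp
  obtain Y' k where k: "k \<in> Hom A P Y'" "short_exact A h k"
    using monic_extend_short_exact[OF mh h] .
  have o': "Y' \<in> Obj A"
    using Hom_Obj[OF k(1)] by simp
  have ki: "k \<cdot> i \<in> Hom A X Y'" and kj: "k \<cdot> j \<in> Hom A Y Y'" and bq: "b \<cdot> q \<in> Hom A P I"
    using k P a by auto
  \<comment> \<open>An arrow into one summand that dies in the cokernel comes from \<open>Z\<close>.  Its component in the
    other summand is zero, and that component is monic on \<open>Z\<close>.\<close>
  have my: "monic A (k \<cdot> j)"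
  proof (rule monicI[OF kj])
    fix W t assume t: "t \<in> Hom A W Y" "k \<cdot> j \<cdot> t = Zer A W Y'"
    have oW: "W \<in> Obj A"
      using Hom_Obj[OF t(1)] by simp
    have "k \<cdot> (j \<cdot> t) = Zer A W Y'"
      using t k P by (simp add: assoc)
    then obtain u where u: "u \<in> Hom A W Z" "h \<cdot> u = j \<cdot> t"
      using short_exact_kernelE[OF k(2) h k(1), of "j \<cdot> t" W] t P by auto
    have "z \<cdot> u = p \<cdot> (h \<cdot> u)"
      using ph h P(4) u(1) by (auto simp flip: assoc)
    also have "\<dots> = p \<cdot> j \<cdot> t"
      using u(2) P t(1) by (simp add: assoc)
    also have "\<dots> = Zer A W X"
      using pj t(1) o by simp
    finally have "u = Zer A W Z"
      using monic_Zer[OF z u(1)] by simp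
    then have "q \<cdot> (j \<cdot> t) = Zer A W Y"
      using u(2) h P oW by (metis Cmp_Zer_right Hom_iff)
    then show "t = Zer A W Y"
      using qj t(1) P by (simp flip: assoc)
  qed
  have mx: "monic A (k \<cdot> i)"
  proof (rule monicI[OF ki])
    fix W t assume t: "t \<in> Hom A W X" "k \<cdot> i \<cdot> t = Zer A W Y'"
    have oW: "W \<in> Obj A"
      using Hom_Obj[OF t(1)] by simp
    have "k \<cdot> (i \<cdot> t) = Zer A W Y'"
      using t k P by (simp add: assoc)
    then obtain u where u: "u \<in> Hom A W Z" "h \<cdot> u = i \<cdot> t"
      using short_exact_kernelE[OF k(2) h k(1), of "i \<cdot> t" W] t P by auto
    have "a \<cdot> u = q \<cdot> (h \<cdot> u)"
      using qh h P(5) u(1) by (auto simp flip: assoc)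
    also have "\<dots> = q \<cdot> i \<cdot> t"
      using u(2) P t(1) by (simp add: assoc)
    also have "\<dots> = Zer A W Y"
      using qi t(1) o by simp
    finally have "u = Zer A W Z"
      using monic_Zer[OF short_exactD(3)[OF a(1)] a(2) u(1)] by simp
    then have "p \<cdot> (i \<cdot> t) = Zer A W X"
      using u(2) h P oW by (metis Cmp_Zer_right Hom_iff)
    then show "t = Zer A W X"
      using pi t(1) P by (simp flip: assoc)
  qed
  have "b \<cdot> q \<cdot> h = b \<cdot> a"
    using qh a h P by (simp add: assoc)
  then have "b \<cdot> q \<cdot> h = Zer A Z I"
    using short_exact_Zer[OF a] by simp
  then obtain b' where b': "b' \<in> Hom A Y' I" "b' \<cdot> k = b \<cdot> q"
    using short_exact_cokernelE[OF k(2) h k(1) bq] by metis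
  have bki: "b' \<cdot> (k \<cdot> i) = Zer A X I"
  proof -
    have "b' \<cdot> (k \<cdot> i) = b \<cdot> q \<cdot> i"
      using b' k P by (auto simp flip: assoc)
    then show ?thesis
      using qi a P o by (simp add: assoc)
  qed
  have "epic A b'"
  proof -
    have "b' \<cdot> (k \<cdot> j) = b \<cdot> q \<cdot> j"
      using b' k P by (auto simp flip: assoc)
    then have "b' \<cdot> (k \<cdot> j) = b"
      using qj a P o by (simp add: assoc)
    then show ?thesis
      using epic_left_factor[OF _ kj b'(1)] short_exactD(4)[OF a(1)] by simp
  qed
  then have "is_cokernel A (k \<cdot> i) b'"
  proof (rule cokernelI[OF _ ki b'(1) bki])
    fix W t assume t: "t \<in> Hom A Y' W" "t \<cdot> (k \<cdot> i) = Zer A X W"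
    have oW: "W \<in> Obj A"
      using Hom_Obj[OF t(1)] by simp
    have tk: "t \<cdot> k \<in> Hom A P W"
      using t k by simp
    have kh: "k \<cdot> h = Zer A Z Y'"
      using short_exact_Zer[OF k(2) h k(1)] .
    have "Zer A Z W = t \<cdot> k \<cdot> h"
      using kh t(1) k h o by (simp add: assoc)
    also have "\<dots> = (t \<cdot> k \<cdot> (i \<cdot> z)) \<boxplus> (t \<cdot> k \<cdot> (j \<cdot> a))"
      unfolding h_def using Cmp_Add_right[OF iz ja tk] .
    also have "t \<cdot> k \<cdot> (i \<cdot> z) = (t \<cdot> (k \<cdot> i)) \<cdot> z"
      using t(1) k P z by (simp add: assoc)
    also have "\<dots> = Zer A Z W"
      using t(2) z oW by simp
    also have "Zer A Z W \<boxplus> (t \<cdot> k \<cdot> (j \<cdot> a)) = t \<cdot> k \<cdot> (j \<cdot> a)"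
      using Add_Zer_left[OF Cmp_closed[OF ja tk]] .
    also have "\<dots> = (t \<cdot> k \<cdot> j) \<cdot> a"
      using t(1) k P a by (simp add: assoc)
    finally obtain v where v: "v \<in> Hom A I W" "v \<cdot> b = t \<cdot> k \<cdot> j"
      using short_exact_cokernelE[OF a, of "t \<cdot> k \<cdot> j" W] t k P by auto
    have ip: "i \<cdot> p \<in> Hom A P P" and jq: "j \<cdot> q \<in> Hom A P P"
      using P by auto
    have "t \<cdot> k = t \<cdot> k \<cdot> ((i \<cdot> p) \<boxplus> (j \<cdot> q))"
      using sum tk by simp
    also have "\<dots> = (t \<cdot> k \<cdot> (i \<cdot> p)) \<boxplus> (t \<cdot> k \<cdot> (j \<cdot> q))"
      using Cmp_Add_right[OF ip jq tk] .
    also have "t \<cdot> k \<cdot> (i \<cdot> p) = (t \<cdot> (k \<cdot> i)) \<cdot> p"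
      using t(1) k P by (simp add: assoc)
    also have "\<dots> = Zer A P W"
      using t(2) P oW by simp
    also have "Zer A P W \<boxplus> (t \<cdot> k \<cdot> (j \<cdot> q)) = t \<cdot> k \<cdot> (j \<cdot> q)"
      using Add_Zer_left[OF Cmp_closed[OF jq tk]] .
    also have "\<dots> = v \<cdot> b \<cdot> q"
      using v(2) t(1) k P by (simp add: assoc)
    also have "\<dots> = v \<cdot> b' \<cdot> k"
      using b' v(1) a(3) P k by (simp add: assoc)
    finally have "t = v \<cdot> b'"
      using epic_cancel[OF short_exactD(4)[OF k(2)] k(1), of t W "v \<cdot> b'"] t(1) v(1) b'(1) by simp
    then show "\<exists>u\<in>Hom A I W. u \<cdot> b' = t"
      using v(1) by blast
  qed
  then show thesis
    using that[OF ki b'(1) short_exact_of_cokernel[OF mx] kj my] by blast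
qed

lemma epic_Idn: "X \<in> Obj A \<Longrightarrow> epic A (Idn A X)"
  by (auto simp: epic_def)

lemma iso_arr_monic_epic:
  assumes "iso_arr A f"
  shows "monic A f" "epic A f"
proof -
  obtain X Y where f: "f \<in> Hom A X Y"
    using assms by (auto simp: iso_arr_def)
  then obtain g where g: "g \<in> Hom A Y X" "g \<cdot> f = Idn A X" "f \<cdot> g = Idn A Y"
    using assms by (auto simp: iso_arr_def)
  show "monic A f"
    using monic_right_factor[OF _ f g(1)] monic_Idn g(2) Hom_Obj[OF f] by simp
  show "epic A f"
    using epic_left_factor[OF _ g(1) f] epic_Idn g(3) Hom_Obj[OF f] by simp
qed

lemma inverseE:
  assumes "monic A f" "epic A f" "f \<in> Hom A X Y"
  obtains g where "g \<in> Hom A Y X" "g \<cdot> f = Idn A X" "f \<cdot> g = Idn A Y"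
    "monic A g" "epic A g"
proof -
  obtain g where g: "g \<in> Hom A Y X" "g \<cdot> f = Idn A X" "f \<cdot> g = Idn A Y"
    using iso_arr_of_monic_epic[OF assms(1,2)] assms(3) unfolding iso_arr_def by auto
  then have "iso_arr A g"
    using assms(3) unfolding iso_arr_def by auto
  then show thesis
    using that g iso_arr_monic_epic by blast
qed

lemma monic_from_zero_obj:
  assumes "zero_obj A Z" "f \<in> Hom A Z X"
  shows "monic A f"
  using monicI[OF assms(2)] zero_obj_Zer(1)[OF assms(1)] by blast

lemma epic_into_zero_obj:
  assumes "zero_obj A Z" "f \<in> Hom A X Z"
  shows "epic A f"
  unfolding epic_def
proof (intro conjI ballI impI)
  show "f \<in> Arr A"
    using assms(2) by simp
  have Z: "Tgt A f = Z"
    using assms(2) by simp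
  fix W u v assume "u \<in> Hom A (Tgt A f) W" "v \<in> Hom A (Tgt A f) W"
  then show "u = v"
    using zero_obj_Zer(2)[OF assms(1)] unfolding Z by metis
qed

lemma zero_obj_quotient:
  assumes "zero_obj A Z" "epic A e" "e \<in> Hom A Z N"
  shows "zero_obj A N"
proof (rule zero_objI)
  show N: "N \<in> Obj A"
    using Hom_Obj[OF assms(3)] by simp
  have "Idn A N \<cdot> e = Zer A Z N"
    using zero_obj_Zer(2)[OF assms(1,3)] assms(3) by simp
  then show "Idn A N = Zer A N N"
    using epic_Zer[OF assms(2,3), of "Idn A N" N] N by simp
qed

section \<open>Torsion-free classes\<close>

text \<open>
  Closure under isomorphism is not a separate condition, since isomorphisms are monic.
\<close>

lemma torfI:
  assumes "T \<subseteq> Obj A" "Z \<in> T" "zero_obj A Z" "ext_closed A T" "subobject_closed A T"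
  shows "T \<in> torf A"
proof -
  have "Y \<in> T" if X: "X \<in> T" "isomorphic A X Y" for X Y
  proof -
    obtain f where f: "f \<in> Hom A X Y" "monic A f" "epic A f"
      using X(2) iso_arr_monic_epic unfolding isomorphic_def by blast
    obtain g where "g \<in> Hom A Y X" "monic A g"
      using inverseE[OF f(2,3,1)] by metis
    then show ?thesis
      using X(1) assms(5) unfolding subobject_closed_def by auto
  qed
  then show ?thesis
    using assms unfolding torf_def subcategory_def by blast
qed

lemma torf_Obj: "T \<in> torf A \<Longrightarrow> X \<in> T \<Longrightarrow> X \<in> Obj A"
  by (auto simp: torf_def subcategory_def)

lemma torf_subobject:
  assumes "T \<in> torf A" "monic A m" "m \<in> Hom A X Y" "Y \<in> T"
  shows "X \<in> T"
  using assms unfolding torf_def subobject_closed_def by auto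

lemma torf_extension:
  assumes "T \<in> torf A" "short_exact A f g" "f \<in> Hom A X Y" "g \<in> Hom A Y Z" "X \<in> T" "Z \<in> T"
  shows "Y \<in> T"
  using assms unfolding torf_def ext_closed_def by auto

lemma torf_zero_obj:
  assumes "T \<in> torf A" "zero_obj A Z"
  shows "Z \<in> T"
proof -
  obtain Z' where Z': "Z' \<in> T" "Z' \<in> Obj A"
    using assms(1) torf_Obj unfolding torf_def subcategory_def by blast
  have "Zer A Z Z' \<in> Hom A Z Z'"
    using Z' assms(2) by (simp add: zero_obj_def)
  then show ?thesis
    using torf_subobject[OF assms(1)] monic_from_zero_obj[OF assms(2)] Z' by blast
qed

lemma Obj_torf: "Obj A \<in> torf A"
proof -
  obtain Z where Z: "zero_obj A Z"
    using ex_zero_obj by blast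
  show ?thesis
  proof (rule torfI[OF subset_refl _ Z])
    show "Z \<in> Obj A"
      using Z by (simp add: zero_obj_def)
    show "ext_closed A (Obj A)"
      using Tgt_closed short_exact_Hom unfolding ext_closed_def by (metis Hom_iff)
    show "subobject_closed A (Obj A)"
      using Src_closed unfolding subobject_closed_def monic_def by blast
  qed
qed

lemma Inter_torf:
  assumes "S \<subseteq> torf A" "S \<noteq> {}"
  shows "\<Inter> S \<in> torf A"
proof -
  obtain Z where Z: "zero_obj A Z"
    using ex_zero_obj by blast
  show ?thesis
  proof (rule torfI[OF _ _ Z])
    show "\<Inter> S \<subseteq> Obj A"
      using assms torf_Obj by blast
    show "Z \<in> \<Inter> S"
      using assms torf_zero_obj[OF _ Z] by blast
    show "ext_closed A (\<Inter> S)"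
      using assms(1) unfolding ext_closed_def torf_def by blast
    show "subobject_closed A (\<Inter> S)"
      using assms(1) unfolding subobject_closed_def torf_def by blast
  qed
qed

lemma torf_closure_torf:
  assumes "C \<subseteq> Obj A"
  shows "torf_closure A C \<in> torf A"
  unfolding torf_closure_def using Obj_torf assms by (intro Inter_torf) auto

lemma torf_closure_superset: "C \<subseteq> torf_closure A C"
  by (auto simp: torf_closure_def)

lemma torf_closure_least: "T \<in> torf A \<Longrightarrow> C \<subseteq> T \<Longrightarrow> torf_closure A C \<subseteq> T"
  by (auto simp: torf_closure_def)

lemma right_perpI:
  assumes "C \<subseteq> Obj A" "M \<in> Obj A" "\<And>X f. X \<in> C \<Longrightarrow> f \<in> Hom A X M \<Longrightarrow> f = Zer A X M"
  shows "M \<in> right_perp A C"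
proof -
  have "Zer A X M \<in> Hom A X M" if "X \<in> C" for X
    using that assms(1,2) by auto
  then show ?thesis
    using assms(2,3) unfolding right_perp_def by blast
qed

lemma left_perpI:
  assumes "C \<subseteq> Obj A" "M \<in> Obj A" "\<And>X f. X \<in> C \<Longrightarrow> f \<in> Hom A M X \<Longrightarrow> f = Zer A M X"
  shows "M \<in> left_perp A C"
proof -
  have "Zer A M X \<in> Hom A M X" if "X \<in> C" for X
    using that assms(1,2) by auto
  then show ?thesis
    using assms(2,3) unfolding left_perp_def by blast
qed

lemma right_perp_torf:
  assumes C: "C \<subseteq> Obj A"
  shows "right_perp A C \<in> torf A"
proof -
  obtain Z where Z: "zero_obj A Z"
    using ex_zero_obj by blast
  show ?thesis
  proof (rule torfI[OF _ _ Z])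
    show "right_perp A C \<subseteq> Obj A"
      by (auto simp: right_perp_def)
    show "Z \<in> right_perp A C"
      using right_perpI[OF C, of Z] zero_obj_Zer(1)[OF Z] Z by (simp add: zero_obj_def)
    show "subobject_closed A (right_perp A C)"
      unfolding subobject_closed_def
    proof (intro allI impI, elim conjE)
      fix m assume m: "monic A m" "Tgt A m \<in> right_perp A C"
      then have h: "m \<in> Hom A (Src A m) (Tgt A m)"
        by (simp add: monic_def)
      show "Src A m \<in> right_perp A C"
      proof (rule right_perpI[OF C])
        show "Src A m \<in> Obj A"
          using Hom_Obj[OF h] by simp
        fix X f assume f: "X \<in> C" "f \<in> Hom A X (Src A m)"
        then have "m \<cdot> f \<in> Hom A X (Tgt A m)"
          using h by simp
        then have "m \<cdot> f = Zer A X (Tgt A m)"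
          using m(2) f(1) unfolding right_perp_def by blast
        then show "f = Zer A X (Src A m)"
          using monic_Zer[OF m(1) h f(2)] by simp
      qed
    qed
    show "ext_closed A (right_perp A C)"
      unfolding ext_closed_def
    proof (intro allI impI, elim conjE)
      fix f g
      assume fg: "short_exact A f g" "Src A f \<in> right_perp A C" "Tgt A g \<in> right_perp A C"
      obtain X Y W where h: "f \<in> Hom A X Y" "g \<in> Hom A Y W"
        using short_exact_Hom[OF fg(1)] .
      have X: "X \<in> right_perp A C" and W: "W \<in> right_perp A C"
        using fg h by auto
      have "Y \<in> right_perp A C"
      proof (rule right_perpI[OF C])
        show "Y \<in> Obj A"
          using Hom_Obj[OF h(1)] by simp
        fix D t assume t: "D \<in> C" "t \<in> Hom A D Y"
        have "g \<cdot> t \<in> Hom A D W"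
          using t h by simp
        then have "g \<cdot> t = Zer A D W"
          using W t(1) unfolding right_perp_def by blast
        then obtain u where u: "u \<in> Hom A D X" "f \<cdot> u = t"
          using short_exact_kernelE[OF fg(1) h t(2)] by metis
        have "u = Zer A D X"
          using X u(1) t(1) unfolding right_perp_def by blast
        then show "t = Zer A D Y"
          using u(2) h C t(1) by auto
      qed
      then show "Tgt A f \<in> right_perp A C"
        using h by simp
    qed
  qed
qed

section \<open>Images of maps out of an ICE-closed subcategory\<close>

text \<open>
  The objects \<open>X\<close> such that in every extension \<open>Y\<close> of an object \<open>I\<close> of \<open>C\<close> by \<open>X\<close>, images \<open>M\<close> of objects \<open>D\<close>
  of \<open>C\<close> lie in \<open>C\<close> and have their cokernels \<open>N\<close> in \<open>F\<close>.  The case \<open>I = 0\<close> is a statement about \<open>X\<close>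
  alone; allowing all \<open>I\<close> is what makes the class closed under extensions.
\<close>

definition stable_images :: "'a set \<Rightarrow> 'a set \<Rightarrow> 'a set" where
  "stable_images C F = {X \<in> Obj A. \<forall>Y I a b D M N e m c.
    I \<in> C \<and> a \<in> Hom A X Y \<and> b \<in> Hom A Y I \<and> short_exact A a b \<and>
    D \<in> C \<and> e \<in> Hom A D M \<and> epic A e \<and>
    m \<in> Hom A M Y \<and> c \<in> Hom A Y N \<and> short_exact A m c \<longrightarrow> M \<in> C \<and> N \<in> F}"

lemma stable_imagesI:
  assumes "X \<in> Obj A"
    and "\<And>Y I a b D M N e m c. \<lbrakk>I \<in> C; a \<in> Hom A X Y; b \<in> Hom A Y I; short_exact A a b;
      D \<in> C; e \<in> Hom A D M; epic A e; m \<in> Hom A M Y; c \<in> Hom A Y N; short_exact A m c\<rbrakk>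
      \<Longrightarrow> M \<in> C \<and> N \<in> F"
  shows "X \<in> stable_images C F"
  unfolding stable_images_def
  by (intro CollectI conjI[OF assms(1)] allI impI, elim conjE) (rule assms(2))

lemma stable_imagesD:
  assumes "X \<in> stable_images C F" "I \<in> C" "a \<in> Hom A X Y" "b \<in> Hom A Y I" "short_exact A a b"
    "D \<in> C" "e \<in> Hom A D M" "epic A e" "m \<in> Hom A M Y" "c \<in> Hom A Y N" "short_exact A m c"
  shows "M \<in> C" "N \<in> F"
proof -
  have *: "\<forall>Y I a b D M N e m c.
    I \<in> C \<and> a \<in> Hom A X Y \<and> b \<in> Hom A Y I \<and> short_exact A a b \<and>
    D \<in> C \<and> e \<in> Hom A D M \<and> epic A e \<and>
    m \<in> Hom A M Y \<and> c \<in> Hom A Y N \<and> short_exact A m c \<longrightarrow> M \<in> C \<and> N \<in> F"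
    using CollectD[OF assms(1)[unfolded stable_images_def]] by (rule conjunct2)
  have "M \<in> C \<and> N \<in> F"
    using *[rule_format, of I a Y b D e M m c N] assms(2-) by blast
  then show "M \<in> C" "N \<in> F"
    by auto
qed

text \<open>
  Extension closure puts \<open>Y\<close> into \<open>C\<close>, and there closure under images and cokernels applies.
\<close>

lemma ICE_closed_subset_stable_images:
  assumes C: "ICE_closed A C" and F: "C \<subseteq> F"
  shows "C \<subseteq> stable_images C F"
proof
  fix X assume X: "X \<in> C"
  show "X \<in> stable_images C F"
  proof (rule stable_imagesI)
    show "X \<in> Obj A"
      using C X by (auto simp: ICE_closed_def subcategory_def)
    fix Y I a b D M N e m c
    assume I: "I \<in> C" and a: "a \<in> Hom A X Y" "b \<in> Hom A Y I" "short_exact A a b"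
      and e: "D \<in> C" "e \<in> Hom A D M" "epic A e"
      and m: "m \<in> Hom A M Y" "c \<in> Hom A Y N" "short_exact A m c"
    have Y: "Y \<in> C"
      using C X I a unfolding ICE_closed_def ext_closed_def by auto
    have me: "m \<cdot> e \<in> Hom A D Y"
      using m e by simp
    have "M \<in> C"
      using is_image_of_factorization(2)[OF e(3,2) m(1,3,2)] C Y e(1) me m
      unfolding ICE_closed_def image_closed_def by auto
    moreover have "N \<in> C"
      using is_image_of_factorization(1)[OF e(3,2) m(1,3,2)] C Y e(1) me m
      unfolding ICE_closed_def coker_closed_def by auto
    ultimately show "M \<in> C \<and> N \<in> F"
      using F by blast
  qed
qed

text \<open>
  For \<open>Z \<subseteq> X\<close>, an extension \<open>Y\<close> of \<open>I\<close> by \<open>Z\<close> embeds in an extension \<open>Y'\<close> of \<open>I\<close> by \<open>X\<close>.  A subobject \<open>M\<close> of \<open>Y\<close>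
  is also one of \<open>Y'\<close>, and \<open>Y / M\<close> embeds in \<open>Y' / M\<close>.
\<close>

lemma stable_images_subobject_closed:
  assumes F: "F \<in> torf A"
  shows "subobject_closed A (stable_images C F)"
  unfolding subobject_closed_def
proof (intro allI impI, elim conjE)
  fix z assume z: "monic A z" "Tgt A z \<in> stable_images C F"
  obtain Z X where hz: "z \<in> Hom A Z X"
    using z by (auto simp: monic_def)
  then have X: "X \<in> stable_images C F"
    using z by simp
  have "Z \<in> stable_images C F"
  proof (rule stable_imagesI)
    show "Z \<in> Obj A"
      using Hom_Obj[OF hz] by simp
    fix Y I a b D M N e m c
    assume I: "I \<in> C" and a: "a \<in> Hom A Z Y" "b \<in> Hom A Y I" "short_exact A a b"
      and e: "D \<in> C" "e \<in> Hom A D M" "epic A e"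
      and m: "m \<in> Hom A M Y" "c \<in> Hom A Y N" "short_exact A m c"
    obtain Y' x y b' where x: "x \<in> Hom A X Y'" "b' \<in> Hom A Y' I" "short_exact A x b'"
      and y: "y \<in> Hom A Y Y'" "monic A y"
      using pushout_short_exact[OF z(1) hz a(3,1,2)] by metis
    have ym: "y \<cdot> m \<in> Hom A M Y'"
      using y m by simp
    have mym: "monic A (y \<cdot> m)"
      using monic_Cmp[OF short_exactD(3)[OF m(3)] y(2) m(1) y(1)] .
    obtain N' c' where c': "c' \<in> Hom A Y' N'" "short_exact A (y \<cdot> m) c'"
      using monic_extend_short_exact[OF mym ym] .
    note good = stable_imagesD[OF X I x e ym c']
    have cy: "c' \<cdot> y \<in> Hom A Y N'"
      using c' y by simp
    have cym: "c' \<cdot> y \<cdot> m = Zer A M N'"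
      using short_exact_Zer[OF c'(2) ym c'(1)] c'(1) y m by (simp add: assoc)
    have "is_kernel A (c' \<cdot> y) m"
    proof (rule kernelI[OF short_exactD(3)[OF m(3)] m(1) cy cym])
      fix W t assume t: "t \<in> Hom A W Y" "c' \<cdot> y \<cdot> t = Zer A W N'"
      then have "c' \<cdot> (y \<cdot> t) = Zer A W N'"
        using c' y by (simp add: assoc)
      then obtain u where u: "u \<in> Hom A W M" "y \<cdot> m \<cdot> u = y \<cdot> t"
        using short_exact_kernelE[OF c'(2) ym c'(1), of "y \<cdot> t" W] t y by auto
      then have "m \<cdot> u = t"
        using monic_cancel[OF y(2,1), of "m \<cdot> u" W t] t m y by (simp add: assoc)
      then show "\<exists>u\<in>Hom A W M. m \<cdot> u = t"
        using u by blast
    qed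
    moreover obtain n where n: "n \<in> Hom A N N'" "n \<cdot> c = c' \<cdot> y"
      using short_exact_cokernelE[OF m(3,1,2) cy cym] .
    ultimately have "monic A n"
      using coimage_monic[OF _ short_exactD(2)[OF m(3)] m(1,2)] by blast
    then show "M \<in> C \<and> N \<in> F"
      using good torf_subobject[OF F _ n(1)] by blast
  qed
  then show "Src A z \<in> stable_images C F"
    using hz by simp
qed

text \<open>
  Let \<open>Y\<close> be an extension of \<open>I\<close> by \<open>X\<close>, with \<open>X' \<subseteq> X\<close> and \<open>X'' = X / X'\<close>.  Then \<open>Q = Y / X'\<close> is an extension
  of \<open>I\<close> by \<open>X''\<close>, so the image \<open>J\<close> of \<open>M\<close> in \<open>Q\<close> lies in \<open>C\<close> and \<open>R = Q / J\<close> lies in \<open>F\<close>.  The preimage \<open>W\<close>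
  of \<open>J\<close> in \<open>Y\<close> contains \<open>M\<close> and is an extension of \<open>J\<close> by \<open>X'\<close>, so \<open>M\<close> lies in \<open>C\<close> and \<open>W / M\<close> in \<open>F\<close>.
  Finally \<open>Y / M\<close> is an extension of \<open>Y / W = R\<close> by \<open>W / M\<close>.
\<close>

lemma stable_images_ext_closed:
  assumes F: "F \<in> torf A"
  shows "ext_closed A (stable_images C F)"
  unfolding ext_closed_def
proof (intro allI impI, elim conjE)
  fix x' x''
  assume x: "short_exact A x' x''" "Src A x' \<in> stable_images C F" "Tgt A x'' \<in> stable_images C F"
  obtain X' X X'' where hx: "x' \<in> Hom A X' X" "x'' \<in> Hom A X X''"
    using short_exact_Hom[OF x(1)] .
  then have X': "X' \<in> stable_images C F" and X'': "X'' \<in> stable_images C F"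
    using x by auto
  have "X \<in> stable_images C F"
  proof (rule stable_imagesI)
    show "X \<in> Obj A"
      using Hom_Obj[OF hx(1)] by simp
    fix Y I a b D M N e m c
    assume I: "I \<in> C" and a: "a \<in> Hom A X Y" "b \<in> Hom A Y I" "short_exact A a b"
      and e: "D \<in> C" "e \<in> Hom A D M" "epic A e"
      and m: "m \<in> Hom A M Y" "c \<in> Hom A Y N" "short_exact A m c"
    have ax: "a \<cdot> x' \<in> Hom A X' Y"
      using a hx by simp
    have max: "monic A (a \<cdot> x')"
      using monic_Cmp[OF short_exactD(3)[OF x(1)] short_exactD(3)[OF a(3)] hx(1) a(1)] .
    obtain Q q where q: "q \<in> Hom A Y Q" "short_exact A (a \<cdot> x') q"
      using monic_extend_short_exact[OF max ax] .
    obtain a' b' where a': "a' \<in> Hom A X'' Q" "b' \<in> Hom A Q I" "short_exact A a' b'"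
      using third_isomorphism[OF x(1) hx a(3,1,2) q(2,1)] by metis
    have qm: "q \<cdot> m \<in> Hom A M Q"
      using q m by simp
    obtain J p j where p: "p \<in> Hom A M J" "j \<in> Hom A J Q" "epic A p" "monic A j"
      and jp: "j \<cdot> p = q \<cdot> m"
      using epic_monic_factorization[OF qm] by metis
    obtain R d where d: "d \<in> Hom A Q R" "short_exact A j d"
      using monic_extend_short_exact[OF p(4,2)] .
    have pe: "p \<cdot> e \<in> Hom A D J" "epic A (p \<cdot> e)"
      using p e epic_Cmp[OF e(3) p(3) e(2) p(1)] by auto
    have J: "J \<in> C" and R: "R \<in> F"
      using stable_imagesD[OF X'' I a' e(1) pe p(2) d] .
    have dj: "d \<cdot> j = Zer A J R"
      using short_exact_Zer[OF d(2) p(2) d(1)] .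
    have dq: "d \<cdot> q \<in> Hom A Y R" "epic A (d \<cdot> q)"
      using d q epic_Cmp[OF short_exactD(4)[OF q(2)] short_exactD(4)[OF d(2)] q(1) d(1)] by auto
    \<comment> \<open>The preimage of \<open>J\<close> under \<open>q\<close>, as the kernel of \<open>Y \<rightarrow> Q / J\<close>; the arrow \<open>r\<close> below is the
      restriction of \<open>q\<close> to it, and \<open>s\<close> the inclusion of \<open>X'\<close>.\<close>
    obtain W w where w: "w \<in> Hom A W Y" "short_exact A w (d \<cdot> q)"
      using epic_extend_short_exact[OF dq(2,1)] .
    have "d \<cdot> q \<cdot> m = d \<cdot> j \<cdot> p"
      using jp d q m(1) p(1,2) by (simp add: assoc)
    also have "\<dots> = Zer A M R"
      using dj p(1) Hom_Obj[OF d(1)] by simp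
    finally obtain m' where m': "m' \<in> Hom A M W" "w \<cdot> m' = m"
      using short_exact_kernelE[OF w(2,1) dq(1) m(1)] by metis
    have mm': "monic A m'"
      using monic_right_factor[OF _ m'(1) w(1)] m'(2) short_exactD(3)[OF m(3)] by simp
    have qw: "q \<cdot> w \<in> Hom A W Q"
      using q w by simp
    have "d \<cdot> (q \<cdot> w) = Zer A W R"
      using short_exact_Zer[OF w(2,1) dq(1)] d(1) q(1) w(1) by (simp add: assoc)
    then obtain r where r: "r \<in> Hom A W J" "j \<cdot> r = q \<cdot> w"
      using short_exact_kernelE[OF d(2) p(2) d(1) qw] by metis
    have "j \<cdot> (r \<cdot> m') = j \<cdot> r \<cdot> m'"
      using p(2) r(1) m'(1) by (simp add: assoc)
    also have "\<dots> = q \<cdot> (w \<cdot> m')"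
      using r(2) q(1) w(1) m'(1) by (simp add: assoc)
    also have "\<dots> = j \<cdot> p"
      using jp m'(2) by simp
    finally have "r \<cdot> m' = p"
      using monic_cancel[OF p(4,2), of "r \<cdot> m'" M p] r(1) m'(1) p(1) by simp
    then have er: "epic A r"
      using epic_left_factor[OF _ m'(1) r(1)] p(3) by simp
    have qax: "q \<cdot> (a \<cdot> x') = Zer A X' Q"
      using short_exact_Zer[OF q(2) ax q(1)] .
    have "d \<cdot> q \<cdot> (a \<cdot> x') = d \<cdot> (q \<cdot> (a \<cdot> x'))"
      using d(1) q(1) ax by (intro assoc) auto
    also have "\<dots> = Zer A X' R"
      using qax d(1) Hom_Obj[OF hx(1)] by simp
    finally obtain s where s: "s \<in> Hom A X' W" "w \<cdot> s = a \<cdot> x'"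
      using short_exact_kernelE[OF w(2,1) dq(1) ax] by metis
    have "is_kernel A r s"
    proof (rule kernelI[OF _ s(1) r(1)])
      show "monic A s"
        using monic_right_factor[OF _ s(1) w(1)] s(2) max by simp
      have "j \<cdot> (r \<cdot> s) = j \<cdot> r \<cdot> s"
        using p(2) r(1) s(1) by (simp add: assoc)
      also have "\<dots> = q \<cdot> (w \<cdot> s)"
        using r(2) q(1) w(1) s(1) by (simp add: assoc)
      also have "\<dots> = Zer A X' Q"
        using qax s(2) by simp
      finally show "r \<cdot> s = Zer A X' J"
        using monic_Zer[OF p(4,2), of "r \<cdot> s" X'] r(1) s(1) by simp
      fix V t assume t: "t \<in> Hom A V W" "r \<cdot> t = Zer A V J"
      have wt: "w \<cdot> t \<in> Hom A V Y"
        using w t by simp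
      have "q \<cdot> (w \<cdot> t) = j \<cdot> r \<cdot> t"
        using r(2) q(1) w(1) t(1) by (simp add: assoc)
      also have "\<dots> = j \<cdot> (r \<cdot> t)"
        using p(2) r(1) t(1) by (simp add: assoc)
      also have "\<dots> = Zer A V Q"
        using t p(2) Hom_Obj[OF t(1)] by simp
      finally obtain u where u: "u \<in> Hom A V X'" "a \<cdot> x' \<cdot> u = w \<cdot> t"
        using short_exact_kernelE[OF q(2) ax q(1) wt] by metis
      have "w \<cdot> (s \<cdot> u) = w \<cdot> s \<cdot> u"
        using w(1) s(1) u(1) by (simp add: assoc)
      then have "s \<cdot> u = t"
        using monic_cancel[OF short_exactD(3)[OF w(2)] w(1), of "s \<cdot> u" V t] u s t(1) by simp
      then show "\<exists>u\<in>Hom A V X'. s \<cdot> u = t"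
        using u by blast
    qed
    then have sr: "short_exact A s r"
      using short_exact_of_kernel[OF er] by blast
    obtain N' c' where c': "c' \<in> Hom A W N'" "short_exact A m' c'"
      using monic_extend_short_exact[OF mm' m'(1)] .
    have M: "M \<in> C" and N': "N' \<in> F"
      using stable_imagesD[OF X' J s(1) r(1) sr e m'(1) c'] .
    have "short_exact A (w \<cdot> m') c"
      using m(3) m'(2) by simp
    then obtain a'' b'' where "a'' \<in> Hom A N' N" "b'' \<in> Hom A N R" "short_exact A a'' b''"
      using third_isomorphism[OF c'(2) m'(1) c'(1) w(2,1) dq(1) _ m(2)] by metis
    then have "N \<in> F"
      using torf_extension[OF F] N' R by blast
    then show "M \<in> C \<and> N \<in> F"
      using M by simp
  qed
  then show "Tgt A x' \<in> stable_images C F"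
    using hx by simp
qed

lemma ICE_closed_zero_obj:
  assumes "ICE_closed A C" "zero_obj A Z"
  shows "Z \<in> C"
proof -
  obtain Z' where Z': "Z' \<in> C" "zero_obj A Z'"
    using assms(1) by (auto simp: ICE_closed_def subcategory_def)
  have o: "Z \<in> Obj A" "Z' \<in> Obj A"
    using assms(2) Z'(2) by (auto simp: zero_obj_def)
  have h: "Zer A Z' Z \<in> Hom A Z' Z"
    using o by simp
  have "epic A (Zer A Z' Z)"
    using epic_into_zero_obj[OF assms(2) h] .
  then have "isomorphic A Z' Z"
    using iso_arr_of_monic_epic[OF monic_from_zero_obj[OF Z'(2) h]] h unfolding isomorphic_def
    by blast
  then show ?thesis
    using assms(1) Z'(1) unfolding ICE_closed_def subcategory_def by blast
qed

text \<open>
  The closure lies in the torsion-free class \<^term>\<open>stable_images C (torf_closure A C)\<close>, by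
  minimality.  The defining property is then used for the trivial extension of a zero object by \<open>X\<close>.
\<close>

lemma ICE_closed_image_in_torf_closure:
  assumes C: "ICE_closed A C" and X: "X \<in> torf_closure A C"
    and e: "D \<in> C" "e \<in> Hom A D M" "epic A e"
    and m: "m \<in> Hom A M X" "c \<in> Hom A X N" "short_exact A m c"
  shows "M \<in> C" "N \<in> torf_closure A C"
proof -
  let ?F = "torf_closure A C"
  have CO: "C \<subseteq> Obj A"
    using C by (auto simp: ICE_closed_def subcategory_def)
  note F = torf_closure_torf[OF CO]
  have sub: "C \<subseteq> stable_images C ?F"
    using ICE_closed_subset_stable_images[OF C torf_closure_superset] .
  obtain Z where Z: "Z \<in> C" "zero_obj A Z"
    using C by (auto simp: ICE_closed_def subcategory_def)
  have "stable_images C ?F \<subseteq> Obj A"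
    by (auto simp: stable_images_def)
  moreover have "Z \<in> stable_images C ?F"
    using sub Z(1) by (rule subsetD)
  ultimately have "stable_images C ?F \<in> torf A"
    using torfI[OF _ _ Z(2) stable_images_ext_closed[OF F] stable_images_subobject_closed[OF F]]
    by simp
  then have XS: "X \<in> stable_images C ?F"
    by (rule subsetD[OF torf_closure_least[OF _ sub] X])
  have oX: "X \<in> Obj A" "Z \<in> Obj A"
    using Hom_Obj[OF m(2)] Z by (auto simp: zero_obj_def)
  have i: "Idn A X \<in> Hom A X X" "Zer A X Z \<in> Hom A X Z"
    using oX by auto
  have "is_cokernel A (Idn A X) (Zer A X Z)"
  proof (rule cokernelI[OF _ i])
    show "epic A (Zer A X Z)"
      using epic_into_zero_obj[OF Z(2) i(2)] .
    show "Zer A X Z \<cdot> Idn A X = Zer A X Z"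
      using i by simp
    fix W t assume t: "t \<in> Hom A X W" "t \<cdot> Idn A X = Zer A X W"
    then have "Zer A Z W \<in> Hom A Z W" "Zer A Z W \<cdot> Zer A X Z = t"
      using oX Hom_Obj[OF t(1)] by auto
    then show "\<exists>u\<in>Hom A Z W. u \<cdot> Zer A X Z = t"
      by blast
  qed
  then have ses: "short_exact A (Idn A X) (Zer A X Z)"
    using short_exact_of_cokernel[OF monic_Idn[OF oX(1)]] by simp
  show "M \<in> C" "N \<in> ?F"
    using stable_imagesD[OF XS Z(1) i ses e m] .
qed

section \<open>Composition length of quotients\<close>

text \<open>
  A recursive form of \<^const>\<open>finite_length\<close> that peels off the top simple factor and keeps track of the
  number of factors, for inductions on the length.
\<close>

primrec has_series :: "nat \<Rightarrow> 'a \<Rightarrow> bool" where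
  "has_series 0 X = zero_obj A X"
| "has_series (Suc n) X = (\<exists>f g. short_exact A f g \<and> Tgt A f = X \<and>
    has_series n (Src A f) \<and> simple_obj A (Tgt A g))"

lemma has_series_SucI:
  assumes "short_exact A f g" "f \<in> Hom A X Y" "g \<in> Hom A Y S" "has_series n X" "simple_obj A S"
  shows "has_series (Suc n) Y"
proof -
  have "Tgt A f = Y" "Src A f = X" "Tgt A g = S"
    using assms(2,3) by auto
  then show ?thesis
    using assms(1,4,5) unfolding has_series.simps by blast
qed

lemma has_series_SucE:
  assumes "has_series (Suc n) Y"
  obtains X S f g where "short_exact A f g" "f \<in> Hom A X Y" "g \<in> Hom A Y S" "has_series n X"
    "simple_obj A S"
proof -
  obtain f g where f: "short_exact A f g" "Tgt A f = Y" "has_series n (Src A f)"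
    "simple_obj A (Tgt A g)"
    using assms by auto
  have "f \<in> Hom A (Src A f) Y" "g \<in> Hom A Y (Tgt A g)"
    using short_exact_Hom[OF f(1)] f(2) by auto
  then show thesis
    using that f by blast
qed

lemma finite_length_has_series:
  assumes "finite_length A X"
  obtains n where "has_series n X"
proof -
  obtain n S s c where S: "zero_obj A (S 0)" "S n = X"
    and s: "\<forall>i<n. s i \<in> Hom A (S i) (S (Suc i)) \<and> short_exact A (s i) (c i) \<and>
      simple_obj A (Tgt A (c i))"
    using assms unfolding finite_length_def by blast
  have "has_series i (S i)" if "i \<le> n" for i
    using that
  proof (induction i)
    case 0
    then show ?case
      using S by simp
  next
    case (Suc i)
    then have i: "s i \<in> Hom A (S i) (S (Suc i))" "short_exact A (s i) (c i)"
      "simple_obj A (Tgt A (c i))" "has_series i (S i)"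
      using s by auto
    then have "c i \<in> Hom A (S (Suc i)) (Tgt A (c i))"
      using short_exact_Hom[OF i(2)] by auto
    then show ?case
      using has_series_SucI i by blast
  qed
  then show thesis
    using that S by blast
qed

lemma short_exact_iso_middle:
  assumes s: "short_exact A s c" "s \<in> Hom A X' X" "c \<in> Hom A X X''"
    and f: "monic A f" "epic A f" "f \<in> Hom A X Y"
  obtains c' where "c' \<in> Hom A Y X''" "short_exact A (f \<cdot> s) c'"
proof -
  obtain g where g: "g \<in> Hom A Y X" "g \<cdot> f = Idn A X" "f \<cdot> g = Idn A Y" "epic A g"
    using inverseE[OF f] by metis
  have fs: "f \<cdot> s \<in> Hom A X' Y" and cg: "c \<cdot> g \<in> Hom A Y X''"
    using s f g by auto
  have "is_cokernel A (f \<cdot> s) (c \<cdot> g)"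
  proof (rule cokernelI[OF _ fs cg])
    show "epic A (c \<cdot> g)"
      using epic_Cmp[OF g(4) short_exactD(4)[OF s(1)] g(1) s(3)] .
    have "c \<cdot> g \<cdot> (f \<cdot> s) = c \<cdot> ((g \<cdot> f) \<cdot> s)"
      using s(2,3) f(3) g(1) by (simp add: assoc)
    then show "c \<cdot> g \<cdot> (f \<cdot> s) = Zer A X' X''"
      using g(2) s short_exact_Zer[OF s] by simp
    fix W t assume t: "t \<in> Hom A Y W" "t \<cdot> (f \<cdot> s) = Zer A X' W"
    then have "t \<cdot> f \<cdot> s = Zer A X' W"
      using f(3) s(2) by (simp add: assoc)
    then obtain u where u: "u \<in> Hom A X'' W" "u \<cdot> c = t \<cdot> f"
      using short_exact_cokernelE[OF s, of "t \<cdot> f" W] t f by auto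
    have "u \<cdot> (c \<cdot> g) = u \<cdot> c \<cdot> g"
      using u(1) s(3) g(1) by (simp add: assoc)
    also have "\<dots> = t \<cdot> (f \<cdot> g)"
      using u(2) t(1) f(3) g(1) by (simp add: assoc)
    also have "\<dots> = t"
      using g(3) t(1) by simp
    finally show "\<exists>u\<in>Hom A X'' W. u \<cdot> (c \<cdot> g) = t"
      using u(1) by blast
  qed
  then show thesis
    using that[OF cg] short_exact_of_cokernel
      monic_Cmp[OF short_exactD(3)[OF s(1)] f(1) s(2) f(3)] by blast
qed

lemma short_exact_iso_right:
  assumes f: "short_exact A f g" "f \<in> Hom A X Y" "g \<in> Hom A Y Z"
    and u: "monic A u" "epic A u" "u \<in> Hom A S Z"
  obtains g' where "g' \<in> Hom A Y S" "short_exact A f g'"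
proof -
  obtain v where v: "v \<in> Hom A Z S" "v \<cdot> u = Idn A S" "u \<cdot> v = Idn A Z" "monic A v" "epic A v"
    using inverseE[OF u] by metis
  have vg: "v \<cdot> g \<in> Hom A Y S"
    using v f by simp
  have "is_kernel A (v \<cdot> g) f"
  proof (rule kernelI[OF short_exactD(3)[OF f(1)] f(2) vg])
    show "v \<cdot> g \<cdot> f = Zer A X S"
      using short_exact_Zer[OF f] v(1) f(2,3) Hom_Obj[OF f(2)] by (simp add: assoc)
    fix W t assume t: "t \<in> Hom A W Y" "v \<cdot> g \<cdot> t = Zer A W S"
    then have "v \<cdot> (g \<cdot> t) = Zer A W S"
      using v(1) f(3) by (simp add: assoc)
    then have "g \<cdot> t = Zer A W Z"
      using monic_Zer[OF v(4,1), of "g \<cdot> t" W] t(1) f(3) by simp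
    then show "\<exists>u\<in>Hom A W X. f \<cdot> u = t"
      using short_exact_kernelE[OF f t(1)] by metis
  qed
  then show thesis
    using that[OF vg] short_exact_of_kernel epic_Cmp[OF short_exactD(4)[OF f(1)] v(5) f(3) v(1)]
    by blast
qed

lemma has_series_iso:
  assumes "has_series n X" "monic A f" "epic A f" "f \<in> Hom A X Y"
  shows "has_series n Y"
proof (cases n)
  case 0
  then show ?thesis
    using assms zero_obj_quotient by auto
next
  case (Suc k)
  then obtain X' S s c where s: "short_exact A s c" "s \<in> Hom A X' X" "c \<in> Hom A X S"
    "has_series k X'" "simple_obj A S"
    using assms(1) has_series_SucE by metis
  obtain c' where c': "c' \<in> Hom A Y S" "short_exact A (f \<cdot> s) c'"
    using short_exact_iso_middle[OF s(1-3) assms(2-4)] .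
  have "f \<cdot> s \<in> Hom A X' Y"
    using s(2) assms(4) by simp
  then show ?thesis
    using has_series_SucI[OF c'(2) _ c'(1) s(4,5)] Suc by blast
qed

text \<open>
  A quotient of \<open>X\<close> by a nonzero subobject is strictly shorter.  Let \<open>X'\<close> be the last proper step of
  the series, with simple factor \<open>S\<close>, and \<open>N'\<close> the image of \<open>X'\<close> in \<open>N\<close>.  Then \<open>N / N'\<close> is a quotient of \<open>S\<close>,
  so it is \<open>S\<close> or zero.  In the first case the induction hypothesis for \<open>X' \<rightarrow> N'\<close> applies: if this is
  monic then so is \<open>X \<rightarrow> N\<close>, and otherwise \<open>N'\<close>, and with it \<open>N\<close>, has fewer factors.  In the second case
  \<open>N\<close> is a quotient of \<open>X'\<close> and thus has at most \<open>n\<close> factors.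
\<close>

lemma has_series_quotient:
  assumes "has_series n X" "epic A e" "e \<in> Hom A X N"
  shows "monic A e \<or> (\<exists>k<n. has_series k N)"
  using assms
proof (induction n arbitrary: X N e)
  case 0
  then show ?case
    using monic_from_zero_obj by auto
next
  case (Suc n)
  note e = Suc.prems(2,3)
  obtain X' S s c where s: "short_exact A s c" and h: "s \<in> Hom A X' X" "c \<in> Hom A X S"
    and X': "has_series n X'" and S: "simple_obj A S"
    using has_series_SucE[OF Suc.prems(1)] by metis
  have es: "e \<cdot> s \<in> Hom A X' N"
    using e h by simp
  obtain N' p j where p: "p \<in> Hom A X' N'" "j \<in> Hom A N' N" "epic A p" "monic A j"
    and jp: "j \<cdot> p = e \<cdot> s"
    using epic_monic_factorization[OF es] by metis
  obtain T d where d: "d \<in> Hom A N T" "short_exact A j d"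
    using monic_extend_short_exact[OF p(4,2)] .
  note dj = short_exact_Zer[OF d(2) p(2) d(1)]
  have de: "d \<cdot> e \<in> Hom A X T" "epic A (d \<cdot> e)"
    using d e epic_Cmp[OF e(1) short_exactD(4)[OF d(2)] e(2) d(1)] by auto
  have "d \<cdot> e \<cdot> s = d \<cdot> j \<cdot> p"
    using jp d(1) e(2) h(1) p(1,2) by (simp add: assoc)
  also have "\<dots> = Zer A X' T"
    using dj p(1) Hom_Obj[OF d(1)] by simp
  finally obtain u where u: "u \<in> Hom A S T" "u \<cdot> c = d \<cdot> e"
    using short_exact_cokernelE[OF s h de(1)] by metis
  obtain K k where k: "k \<in> Hom A K S" "is_kernel A u k"
    using kernel_obtain[OF u(1)] .
  consider "zero_obj A K" | "iso_arr A k"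
    using S kernel_monic[OF k(2)] k(1) unfolding simple_obj_def by auto
  then show ?case
  proof cases
    case 1
    \<comment> \<open>The quotient \<open>T = N / N'\<close> is isomorphic to \<open>S\<close>.\<close>
    have mu: "monic A u"
    proof (rule monicI[OF u(1)])
      fix W t assume t: "t \<in> Hom A W S" "u \<cdot> t = Zer A W T"
      obtain w where w: "w \<in> Hom A W K" "k \<cdot> w = t"
        using kernelE[OF k(2,1) u(1) t] .
      then show "t = Zer A W S"
        using zero_obj_Zer(1)[OF 1 w(1)] k(1) Hom_Obj[OF w(1)] by auto
    qed
    have eu: "epic A u"
      using epic_left_factor[OF _ h(2) u(1)] u(2) de(2) by simp
    obtain d' where d': "d' \<in> Hom A N S" "short_exact A j d'"
      using short_exact_iso_right[OF d(2) p(2) d(1) mu eu u(1)] .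
    consider "monic A p" | l where "l < n" "has_series l N'"
      using Suc.IH[OF X' p(3,1)] by blast
    then show ?thesis
    proof cases
      case 1
      have "monic A e"
      proof (rule monicI[OF e(2)])
        fix W t assume t: "t \<in> Hom A W X" "e \<cdot> t = Zer A W N"
        have "u \<cdot> (c \<cdot> t) = d \<cdot> e \<cdot> t"
          using u h(2) t(1) by (auto simp flip: assoc)
        also have "\<dots> = d \<cdot> (e \<cdot> t)"
          using d(1) e(2) t(1) by (simp add: assoc)
        also have "\<dots> = Zer A W T"
          using t d(1) Hom_Obj[OF t(1)] by simp
        finally have "c \<cdot> t = Zer A W S"
          using monic_Zer[OF mu u(1), of "c \<cdot> t" W] t(1) h(2) by simp
        then obtain t' where t': "t' \<in> Hom A W X'" "s \<cdot> t' = t"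
          using short_exact_kernelE[OF s h t(1)] by metis
        have "j \<cdot> p \<cdot> t' = Zer A W N"
          using jp t' t(2) e(2) h(1) by (simp add: assoc)
        then have "t' = Zer A W X'"
          using monic_Zer[OF monic_Cmp[OF 1 p(4,1,2)], of X' N t' W] t'(1) p by simp
        then show "t = Zer A W X"
          using t' h(1) Hom_Obj[OF t(1)] by auto
      qed
      then show ?thesis
        by simp
    next
      case (2 l)
      have "has_series (Suc l) N"
        using has_series_SucI[OF d'(2) p(2) d'(1) 2(2) S] .
      then show ?thesis
        using 2 by blast
    qed
  next
    case 2
    \<comment> \<open>Here \<open>T\<close> vanishes, so \<open>j\<close> is invertible and already \<open>X'\<close> maps onto \<open>N\<close>.\<close>
    have "u \<cdot> k = Zer A K T"
      using is_kernelD(4)[OF k(2)] u k by simp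
    then have "u = Zer A S T"
      using epic_Zer[OF iso_arr_monic_epic(2)[OF 2] k(1) u(1)] by simp
    then have "d \<cdot> e = Zer A X T"
      using u h(2) Hom_Obj[OF u(1)] by auto
    then have "d = Zer A N T"
      using epic_Zer[OF e d(1)] by simp
    then have "d \<cdot> Idn A N = Zer A N T"
      using d(1) Hom_Obj[OF d(1)] by simp
    then obtain w where w: "w \<in> Hom A N N'" "j \<cdot> w = Idn A N"
      using short_exact_kernelE[OF d(2) p(2) d(1), of "Idn A N" N] Hom_Obj[OF d(1)] by auto
    have "epic A j"
      using epic_left_factor[OF _ w(1) p(2)] w(2) epic_Idn Hom_Obj[OF d(1)] by simp
    then have ees: "epic A (e \<cdot> s)"
      using epic_Cmp[OF p(3) _ p(1,2)] jp by simp
    show ?thesis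
      using Suc.IH[OF X' ees es] has_series_iso[OF X' _ ees es] less_Suc_eq by blast
  qed
qed

end

section \<open>ICE-closed subcategories are hearts\<close>

theorem proposition3p1:
  fixes A :: "('o, 'm) preadd_data" and C :: "'o set"
  assumes "abelian_length_category A"
    and "ICE_closed A C"
  shows "torf_closure A C \<inter> right_perp A C \<in> torf A \<and>
    torf_closure A C \<in> torf A \<and>
    torf_closure A C \<inter> right_perp A C \<subseteq> torf_closure A C \<and>
    C = heart A (torf_closure A C \<inter> right_perp A C) (torf_closure A C) \<and>
    C = torf_closure A C \<inter> left_perp A (torf_closure A C \<inter> right_perp A C)"
proof -
  interpret abelian_length_category A
    by fact
  let ?F = "torf_closure A C"
  let ?G = "?F \<inter> right_perp A C"
  have C: "C \<subseteq> Obj A"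
    using assms(2) by (auto simp: ICE_closed_def subcategory_def)
  have F: "?F \<in> torf A"
    using torf_closure_torf[OF C] .
  have G: "?G \<in> torf A"
    using Inter_torf[of "{?F, right_perp A C}"] F right_perp_torf[OF C] by simp
  have GO: "?G \<subseteq> Obj A"
    using torf_Obj[OF G] by blast
  have "X \<in> left_perp A ?G" if X: "X \<in> C" for X
  proof (rule left_perpI[OF GO])
    show "X \<in> Obj A"
      using X C by blast
    show "f = Zer A X Y" if "Y \<in> ?G" "f \<in> Hom A X Y" for Y f
      using that X unfolding right_perp_def by blast
  qed
  then have "C \<subseteq> ?F \<inter> left_perp A ?G"
    using torf_closure_superset by blast
  moreover have "X \<in> C" if "has_series n X" "X \<in> ?F" "X \<in> left_perp A ?G" for n X
    using that
  proof (induction n arbitrary: X rule: less_induct)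
    case (less n)
    have oX: "X \<in> Obj A"
      using torf_Obj[OF F less.prems(2)] .
    show ?case
    proof (cases "X \<in> right_perp A C")
      case True
      then have "Hom A X X = {Zer A X X}"
        using less.prems unfolding left_perp_def by blast
      then have "zero_obj A X"
        using zero_objI[OF oX] Idn_closed[OF oX] by blast
      then show ?thesis
        using ICE_closed_zero_obj[OF assms(2)] by blast
    next
      case False
      then obtain D f where f: "D \<in> C" "f \<in> Hom A D X" "f \<noteq> Zer A D X"
        using right_perpI[OF C oX] by blast
      obtain M e m where e: "e \<in> Hom A D M" "epic A e" and m: "m \<in> Hom A M X" "monic A m"
        and me: "m \<cdot>\<^bsub>A\<^esub> e = f"
        using epic_monic_factorization[OF f(2)] by metis
      obtain N c where c: "c \<in> Hom A X N" "short_exact A m c"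
        using monic_extend_short_exact[OF m(2,1)] .
      have M: "M \<in> C" and N: "N \<in> ?F"
        using ICE_closed_image_in_torf_closure[OF assms(2) less.prems(2) f(1) e m(1) c] .
      have ec: "epic A c"
        using short_exactD(4)[OF c(2)] .
      have NH: "N \<in> left_perp A ?G"
      proof (rule left_perpI[OF GO torf_Obj[OF F N]])
        fix Y t assume t: "Y \<in> ?G" "t \<in> Hom A N Y"
        then have "t \<cdot>\<^bsub>A\<^esub> c \<in> Hom A X Y"
          using c by simp
        then have "t \<cdot>\<^bsub>A\<^esub> c = Zer A X Y"
          using less.prems(3) t(1) unfolding left_perp_def by blast
        then show "t = Zer A N Y"
          using epic_Zer[OF ec c(1) t(2)] by simp
      qed
      have "\<not> monic A c"
      proof
        assume "monic A c"
        then have "m = Zer A M X"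
          using monic_Zer[OF _ c(1) m(1)] short_exact_Zer[OF c(2) m(1) c(1)] by simp
        then show False
          using me[symmetric] f(3) e(1) oX by simp
      qed
      then obtain k where "k < n" "has_series k N"
        using has_series_quotient[OF less.prems(1) ec c(1)] by blast
      then have "N \<in> C"
        using less.IH N NH by blast
      then show ?thesis
        using assms(2) M m(1) c unfolding ICE_closed_def ext_closed_def by auto
    qed
  qed
  then have "X \<in> C" if "X \<in> ?F" "X \<in> left_perp A ?G" for X
    using finite_length_has_series[OF finite_length[OF torf_Obj[OF F that(1)]]] that by metis
  ultimately have "C = ?F \<inter> left_perp A ?G"
    by blast
  then show ?thesis
    using F G unfolding heart_def by simp
qed

end
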